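(* For every integer $n\ge 1$, the following identity of polynomials in $t$ and $z$ holds: \[\sum_{k=0}^{n-1}\left(\sum_{P\in \mathsf{stLD}(n)^{\bullet k}}t^{\mathsf{area}(P)}(-1)^{\mathsf{dinv}(P)}\right)z^k=\sum_{\sigma\in\mathfrak S_n}t^{\mathsf{inv}_3(\sigma)}z^{\mathsf{monot}(\sigma)},\] where $\mathsf{stLD}(n)^{\bullet k}$ is the set of standardly labelled Dyck paths of size $n$ with $k$ decorated contractible valleys.
   Context: Dyck paths. A Dyck path of size $n$ is a lattice path from $(0,0)$ to $(n,n)$ with unit north and east steps staying weakly above the line $x=y$. A standardly labelled Dyck path is a pair $(\pi,w)$ with $\pi$ a Dyck path of size $n$ and $w=w_1\cdots w_n$ a permutation of $\{1,\dots,n\}$, where $w_i$ labels the $i$-th vertical (north) step of $\pi$, such that the labels of vertical steps lying in the same column are increasing from bottom to top. The area word $a=a_1\cdots a_n$ of $\pi$: $a_i$ is the number of whole unit squares between the $i$-th vertical step and the line $x=y$ (in the row of that step). The $i$-th vertical step ($2\le i\le n$) is a contractible valley of $(\pi,w)$ if either $a_{i-1}>a_i$, or $a_{i-1}=a_i$ and $w_{i-1}<w_i$. The set $\mathsf{stLD}(n)^{\bullet k}$ consists of the triples $P=(\pi,w,dv)$ with $(\pi,w)$ a standardly labelled Dyck path of size $n$ and $dv$ a $k$-element subset of (the indices of) its contractible valleys (the decorated valleys). Statistics on paths. $\mathsf{area}(P)=\sum_{i=1}^n a_i$. A pair $(i,j)$ with $1\le i<j\le n$ is a primary diagonal inversion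 if $a_i=a_j$, $w_i<w_j$ and $i\notin dv$; it is a secondary diagonal inversion if $a_i=a_j+1$, $w_i>w_j$ and $i\notin dv$. $\mathsf{dinv}(P)$ is the total number of primary and secondary diagonal inversions minus the number $|dv|$ of decorated valleys. Statistics on permutations. For $\sigma\in\mathfrak S_n$ put $\sigma_0=0$. For $i\in\{2,\dots,n\}$, $\sigma_i$ is a double ascent if $\sigma_{i-2}<\sigma_{i-1}<\sigma_i$; a double descent if $\sigma_{i-2}>\sigma_{i-1}>\sigma_i$; a peak if $\sigma_{i-2}<\sigma_{i-1}>\sigma_i$; a valley if $\sigma_{i-2}>\sigma_{i-1}<\sigma_i$. $\mathsf{monot}(\sigma)$ is the number of $i\in\{2,\dots,n\}$ such that $\sigma_i$ is a double ascent or a double descent. A pair $(i,j)$ with $1\le i<j\le n$ is a $3$-inversion of $\sigma$ if one of the following holds: $\sigma_j$ is a double ascent and $\sigma_{j-1}<\sigma_i<\sigma_j$; $\sigma_j$ is a double descent and $\sigma_{j-1}>\sigma_i>\sigma_j$; $\sigma_j$ is a peak and $\sigma_i>\sigma_j$; $\sigma_j$ is a valley and $\sigma_i<\sigma_j$. $\mathsf{inv}_3(\sigma)$ is the number of $3$-inversions of $\sigma$. *)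

theory Defs
  imports
    "HOL-Combinatorics.Permutations"
    "HOL-Computational_Algebra.Polynomial"
begin

section \<open>Dyck paths\<close>

datatype step = North | East

text \<open>A path starting at the origin is the list of its steps. After the first \<open>m\<close> steps its
  abscissa and ordinate are the numbers of east and north steps among them.\<close>

definition dyck_path :: "nat \<Rightarrow> step list \<Rightarrow> bool" where
  "dyck_path n p \<longleftrightarrow> count_list p North = n \<and> count_list p East = n \<and>
     (\<forall>m \<le> length p. count_list (take m p) East \<le> count_list (take m p) North)"

definition north_pos :: "step list \<Rightarrow> nat \<Rightarrow> nat" where
  "north_pos p i = filter (\<lambda>m. p ! m = North) [0..<length p] ! (i - 1)"

text \<open>North steps are numbered from 1. The \<open>i\<close>-th one goes from \<open>(column p i, i - 1)\<close> to
  \<open>(column p i, i)\<close>.\<close>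

definition column :: "step list \<Rightarrow> nat \<Rightarrow> nat" where
  "column p i = count_list (take (north_pos p i) p) East"

text \<open>The unit square with horizontal extent from \<open>c\<close> to \<open>c + 1\<close> in the row of the \<open>i\<close>-th north
  step has bottom right corner \<open>(c + 1, i - 1)\<close>, so it lies entirely to the left of the line
  \<open>x = y\<close> iff \<open>c + 1 \<le> i - 1\<close>.\<close>

definition area_word :: "step list \<Rightarrow> nat \<Rightarrow> nat" where
  "area_word p i = card {c. column p i \<le> c \<and> c + 1 \<le> i - 1}"

lemma area_word_eq: "area_word p i = i - 1 - column p i"
proof -
  have "{c. column p i \<le> c \<and> c + 1 \<le> i - 1} = {column p i..<i - 1}" by auto
  then show ?thesis by (simp add: area_word_def)
qed

section \<open>Labelled Dyck paths with decorated contractible valleys\<close>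

definition standard_labelling :: "nat \<Rightarrow> step list \<Rightarrow> (nat \<Rightarrow> nat) \<Rightarrow> bool" where
  "standard_labelling n p w \<longleftrightarrow> w permutes {1..n} \<and>
     (\<forall>i\<in>{1..n}. \<forall>j\<in>{1..n}. i < j \<and> column p i = column p j \<longrightarrow> w i < w j)"

definition contractible_valleys :: "nat \<Rightarrow> step list \<Rightarrow> (nat \<Rightarrow> nat) \<Rightarrow> nat set" where
  "contractible_valleys n p w = {i\<in>{2..n}. area_word p (i - 1) > area_word p i \<or>
     (area_word p (i - 1) = area_word p i \<and> w (i - 1) < w i)}"

type_synonym decorated_path = "step list \<times> (nat \<Rightarrow> nat) \<times> nat set"

definition stLD :: "nat \<Rightarrow> nat \<Rightarrow> decorated_path set" where
  "stLD n k = {(p, w, dv). dyck_path n p \<and> standard_labelling n p w \<and>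
     dv \<subseteq> contractible_valleys n p w \<and> card dv = k}"

fun area :: "nat \<Rightarrow> decorated_path \<Rightarrow> nat" where
  "area n (p, w, dv) = (\<Sum>i=1..n. area_word p i)"

definition primary_dinv :: "nat \<Rightarrow> decorated_path \<Rightarrow> (nat \<times> nat) set" where
  "primary_dinv n = (\<lambda>(p, w, dv). {(i, j). 1 \<le> i \<and> i < j \<and> j \<le> n \<and>
     area_word p i = area_word p j \<and> w i < w j \<and> i \<notin> dv})"

definition secondary_dinv :: "nat \<Rightarrow> decorated_path \<Rightarrow> (nat \<times> nat) set" where
  "secondary_dinv n = (\<lambda>(p, w, dv). {(i, j). 1 \<le> i \<and> i < j \<and> j \<le> n \<and>
     area_word p i = area_word p j + 1 \<and> w i > w j \<and> i \<notin> dv})"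

fun dinv :: "nat \<Rightarrow> decorated_path \<Rightarrow> int" where
  "dinv n (p, w, dv) = int (card (primary_dinv n (p, w, dv)))
     + int (card (secondary_dinv n (p, w, dv))) - int (card dv)"

lemma finite_stLD: "finite (stLD n k)"
proof -
  have len: "length p = count_list p North + count_list p East" for p
  proof (induction p)
    case (Cons s p)
    then show ?case by (cases s) auto
  qed simp
  have UNIV_step: "(UNIV :: step set) = {North, East}"
    using step.exhaust by auto
  have "stLD n k \<subseteq> {p. set p \<subseteq> UNIV \<and> length p = 2 * n} \<times> {w. w permutes {1..n}} \<times> Pow {2..n}"
    by (auto simp: stLD_def dyck_path_def standard_labelling_def contractible_valleys_def len)
  moreover have "finite \<dots>"
    by (intro finite_cartesian_product finite_lists_length_eq finite_permutations)
       (simp_all add: UNIV_step)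
  ultimately show ?thesis by (rule finite_subset)
qed

section \<open>Statistics on permutations\<close>

text \<open>A permutation is a function with \<open>\<sigma> permutes {1..n}\<close>. Such a function fixes every number
  outside \<open>{1..n}\<close>, so the convention \<open>\<sigma>\<^sub>0 = 0\<close> is the value \<open>\<sigma> 0 = 0\<close>.\<close>

definition double_ascent :: "nat \<Rightarrow> (nat \<Rightarrow> nat) \<Rightarrow> nat \<Rightarrow> bool" where
  "double_ascent n \<sigma> i \<longleftrightarrow> i \<in> {2..n} \<and> \<sigma> (i - 2) < \<sigma> (i - 1) \<and> \<sigma> (i - 1) < \<sigma> i"

definition double_descent :: "nat \<Rightarrow> (nat \<Rightarrow> nat) \<Rightarrow> nat \<Rightarrow> bool" where
  "double_descent n \<sigma> i \<longleftrightarrow> i \<in> {2..n} \<and> \<sigma> (i - 2) > \<sigma> (i - 1) \<and> \<sigma> (i - 1) > \<sigma> i"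

definition peak :: "nat \<Rightarrow> (nat \<Rightarrow> nat) \<Rightarrow> nat \<Rightarrow> bool" where
  "peak n \<sigma> i \<longleftrightarrow> i \<in> {2..n} \<and> \<sigma> (i - 2) < \<sigma> (i - 1) \<and> \<sigma> (i - 1) > \<sigma> i"

definition valley :: "nat \<Rightarrow> (nat \<Rightarrow> nat) \<Rightarrow> nat \<Rightarrow> bool" where
  "valley n \<sigma> i \<longleftrightarrow> i \<in> {2..n} \<and> \<sigma> (i - 2) > \<sigma> (i - 1) \<and> \<sigma> (i - 1) < \<sigma> i"

definition monot :: "nat \<Rightarrow> (nat \<Rightarrow> nat) \<Rightarrow> nat" where
  "monot n \<sigma> = card {i\<in>{2..n}. double_ascent n \<sigma> i \<or> double_descent n \<sigma> i}"

definition three_inversion :: "nat \<Rightarrow> (nat \<Rightarrow> nat) \<Rightarrow> nat \<Rightarrow> nat \<Rightarrow> bool" where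
  "three_inversion n \<sigma> i j \<longleftrightarrow> 1 \<le> i \<and> i < j \<and> j \<le> n \<and>
     (double_ascent n \<sigma> j \<and> \<sigma> (j - 1) < \<sigma> i \<and> \<sigma> i < \<sigma> j \<or>
      double_descent n \<sigma> j \<and> \<sigma> (j - 1) > \<sigma> i \<and> \<sigma> i > \<sigma> j \<or>
      peak n \<sigma> j \<and> \<sigma> i > \<sigma> j \<or>
      valley n \<sigma> j \<and> \<sigma> i < \<sigma> j)"

definition inv3 :: "nat \<Rightarrow> (nat \<Rightarrow> nat) \<Rightarrow> nat" where
  "inv3 n \<sigma> = card {(i, j). three_inversion n \<sigma> i j}"

section \<open>Polynomials in two variables\<close>

text \<open>Polynomials in \<open>t\<close> and \<open>z\<close> are polynomials in \<open>z\<close> whose coefficients are integer polynomials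
  in \<open>t\<close>.\<close>

definition var_t :: "int poly poly" where
  "var_t = [:[:0, 1:]:]"

definition var_z :: "int poly poly" where
  "var_z = [:0, 1:]"

text \<open>The power of \<open>-1\<close> with an integer exponent, as needed for \<^const>\<open>dinv\<close>, which is an integer
  by definition. The library's \<open>powi\<close> is not available on integers and polynomials.\<close>

definition neg_one_powi :: "int \<Rightarrow> 'a::comm_ring_1" where
  "neg_one_powi d = (if even d then 1 else - 1)"

end

theory Submission
  imports Defs
begin

text \<open>Put \<open>N = n + 1\<close> and encode the \<open>i\<close>-th north step by the integer \<open>x\<^sub>i = N a\<^sub>i - w\<^sub>i\<close>. These integers
  have distinct nonzero residues modulo \<open>N\<close>; a word \<open>x\<^sub>1 \<dots> x\<^sub>n\<close> comes from a labelled path iff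
  \<open>x\<^sub>1 < 0\<close> and \<open>x\<^sub>i\<^sub>+\<^sub>1 < x\<^sub>i + N\<close>; a valley is contractible iff \<open>x\<^sub>i < x\<^sub>i\<^sub>-\<^sub>1\<close>; and the pair
  \<open>i < j\<close> with \<open>i\<close> undecorated is a diagonal inversion iff \<open>0 < x\<^sub>i - x\<^sub>j < N\<close>.

  Fix the set \<open>U\<close> of undecorated and the set \<open>D\<close> of decorated values and sum \<open>(-1)\<^bsup>dinv\<^esup>\<close> over all
  orders. Building the word by inserting \<open>U\<close> upwards and then \<open>D\<close> downwards, each value
  contributes a factor \<open>1 + q + \<dots> + q\<^bsup>h-1\<^esup>\<close> at \<open>q = -1\<close>, where \<open>h\<close> is the number of places
  where it can be inserted. So only the pairs \<open>(U, D)\<close> for which all these counts are odd survive, each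
  with weight one.

  Such pairs are built from the top value downwards: a new bottom value, of arbitrary residue, is
  placed less than \<open>N\<close> below the current one, and this decides whether the current one is decorated.
  Recording how many residues are jumped over at each step gives a code
  \<open>e\<^sub>1, \<dots>, e\<^sub>n\<close> with \<open>e\<^sub>j < j\<close> whose sum is the area and which also determines the number of
  decorations. The numbers of 3-inversions of a permutation at each of its positions form a code
  of the same kind, from which the double ascents and descents are read off by the same rule.\<close>

section \<open>Codes\<close>

text \<open>Codes are listed with the most recent entry first.\<close>

definition codes :: "nat \<Rightarrow> nat list set" where
  "codes n = {es. length es = n \<and> (\<forall>i<n. es ! i < n - i)}"

text \<open>The entries \<open>e < room es\<close> are those that keep the direction (of a permutation) or produce a
  decoration (of a configuration of values).\<close>

fun room :: "nat list \<Rightarrow> nat" where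
  "room [] = 0"
| "room (e # es) = (if e < room es then room es - e else Suc (length es) - e)"

fun mono_steps :: "nat list \<Rightarrow> nat" where
  "mono_steps [] = 0"
| "mono_steps (e # es) = mono_steps es + of_bool (e < room es)"

lemma codes_0: "codes 0 = {[]}"
  by (auto simp: codes_def)

lemma codes_Suc: "codes (Suc n) = (\<lambda>(e, es). e # es) ` ({..n} \<times> codes n)"
proof -
  have "es \<in> codes (Suc n) \<longleftrightarrow> (\<exists>e es'. es = e # es' \<and> e \<le> n \<and> es' \<in> codes n)" for es
    by (cases es) (auto simp: codes_def All_less_Suc2)
  then show ?thesis by force
qed

lemma finite_codes: "finite (codes n)"
  by (induction n) (auto simp: codes_0 codes_Suc)

lemma inj_on_codes: "inj_on (\<lambda>(e, es). e # es) X"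
  by (auto simp: inj_on_def)

lemma card_codes: "card (codes n) = fact n"
  by (induction n) (simp_all add: codes_0 codes_Suc card_image inj_on_codes card_cartesian_product)

lemma sum_codes_Suc:
  fixes f :: "nat list \<Rightarrow> 'a::comm_monoid_add"
  shows "(\<Sum>es\<in>codes (Suc n). f es) = (\<Sum>e\<le>n. \<Sum>es\<in>codes n. f (e # es))"
proof -
  have "(\<Sum>es\<in>codes (Suc n). f es) = (\<Sum>(e, es)\<in>{..n} \<times> codes n. f (e # es))"
    unfolding codes_Suc by (subst sum.reindex[OF inj_on_codes]) (simp add: split_def)
  also have "\<dots> = (\<Sum>e\<le>n. \<Sum>es\<in>codes n. f (e # es))"
    by (simp add: sum.cartesian_product)
  finally show ?thesis .
qed

section \<open>Configurations of undecorated and decorated values\<close>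

locale modulus =
  fixes N :: int
  assumes N_pos: "0 < N"
begin

text \<open>The cardinalities below are the numbers of positions at which an element of \<open>U\<close>, respectively
  of \<open>D\<close>, can be inserted into a word. The base \<open>b\<close>, a lower bound for all values, is \<open>- N\<close> for paths
  and becomes the previous bottom value in the recursion.\<close>

definition gaps_odd :: "int \<Rightarrow> int set \<Rightarrow> bool" where
  "gaps_odd b U \<longleftrightarrow> (\<forall>u\<in>U. odd (card (U \<inter> {u - N<..<u}) + of_bool (u < b + N)))"

definition windows_odd :: "int set \<Rightarrow> int set \<Rightarrow> bool" where
  "windows_odd U D \<longleftrightarrow> (\<forall>d\<in>D. odd (card (U \<inter> {d<..<d + N})))"

lemma gaps_odd_empty [simp]: "gaps_odd b {}"
  by (simp add: gaps_odd_def)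

text \<open>The minimum \<open>u\<close> has no value of \<open>U\<close> below it, so its count is
  odd only if the front is open to it, that is \<open>u < b + N\<close>. If the smallest value above
  it were also below \<open>b + N\<close>, it would have exactly two places, the front and the one
  after \<open>u\<close>. Once all other values are at least \<open>b + N\<close>, the front is
  closed to them, and the place after \<open>u\<close>, open to \<open>v\<close> iff
  \<open>v < u + N\<close>, replaces it: \<open>u\<close> acts as the new base.\<close>

lemma gaps_odd_insert:
  assumes "finite U" and "\<And>v. v \<in> U \<Longrightarrow> u < v" and "b < u"
  shows "gaps_odd b (insert u U) \<longleftrightarrow> u < b + N \<and> (\<forall>v\<in>U. b + N \<le> v) \<and> gaps_odd u U"
proof -
  let ?h = "\<lambda>v. card (insert u U \<inter> {v - N<..<v}) + of_bool (v < b + N)"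
  have u: "insert u U \<inter> {u - N<..<u} = {}"
    using assms(2) by fastforce
  have uU: "u \<notin> U" using assms(2) by blast
  have "?h v = card (U \<inter> {v - N<..<v}) + of_bool (v < u + N)" if "v \<in> U" "b + N \<le> v" for v
  proof -
    have "insert u U \<inter> {v - N<..<v} = (if v < u + N then insert u (U \<inter> {v - N<..<v}) else U \<inter> {v - N<..<v})"
      using assms(2)[OF that(1)] by auto
    then show ?thesis using that assms(1) uU by auto
  qed
  moreover have "gaps_odd b (insert u U) \<longleftrightarrow> odd (?h u) \<and> (\<forall>v\<in>U. odd (?h v))"
    unfolding gaps_odd_def by (rule ball_simps)
  ultimately have step: "gaps_odd b (insert u U) \<longleftrightarrow> odd (?h u) \<and> gaps_odd u U" if "\<forall>v\<in>U. b + N \<le> v"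
    using that unfolding gaps_odd_def[of u U] by metis
  have "\<forall>v\<in>U. b + N \<le> v" if h: "gaps_odd b (insert u U)"
  proof (rule ccontr)
    assume "\<not> (\<forall>v\<in>U. b + N \<le> v)"
    then obtain v where v: "v \<in> U" "v < b + N" by auto
    define m where "m = Min U"
    have m: "m \<in> U" "\<And>v. v \<in> U \<Longrightarrow> m \<le> v"
      using v assms(1) Min_in[of U] by (auto simp: m_def simp del: Min_in)
    have "m < b + N" using m v by force
    moreover have "insert u U \<inter> {m - N<..<m} = {u}"
      using m assms(2,3) \<open>m < b + N\<close> by fastforce
    ultimately have "even (?h m)" by simp
    moreover have "odd (?h m)" using h m(1) unfolding gaps_odd_def by blast
    ultimately show False by blast
  qed
  then show ?thesis using step u by auto
qed

lemma gaps_odd_Min: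
  assumes "finite U" "U \<noteq> {}" "\<And>v. v \<in> U \<Longrightarrow> b < v"
  shows "gaps_odd b U \<longleftrightarrow>
    Min U < b + N \<and> (\<forall>v\<in>U - {Min U}. b + N \<le> v) \<and> gaps_odd (Min U) (U - {Min U})"
proof -
  have "U = insert (Min U) (U - {Min U})"
    using assms Min_in by blast
  moreover have "Min U < v" if "v \<in> U - {Min U}" for v
    using that assms(1) by (simp add: order.not_eq_order_implies_strict)
  ultimately show ?thesis
    using gaps_odd_insert[of "U - {Min U}" "Min U" b] assms by (metis Min_in finite_Diff)
qed

section \<open>Recursion on the bottom value of a configuration\<close>

definition configs :: "int \<Rightarrow> int set \<Rightarrow> (int set \<times> int set) set" where
  "configs b P = {(U, D). finite U \<and> finite D \<and> U \<inter> D = {} \<and>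
     inj_on (\<lambda>x. x mod N) (U \<union> D) \<and> (\<lambda>x. x mod N) ` (U \<union> D) = P \<and>
     (\<forall>x\<in>U \<union> D. b < x) \<and> gaps_odd b U \<and> windows_odd U D}"

text \<open>The representative of the residue \<open>r\<close> from \<open>b\<close> (included) up
  to \<open>b + N\<close> (excluded).\<close>

definition lift :: "int \<Rightarrow> int \<Rightarrow> int" where
  "lift b r = b + (r - b) mod N"

text \<open>When the base drops from \<open>x\<close> to \<open>b\<close>, the old base becomes a value. It has to be decorated iff the
  next undecorated value lies less than \<open>N\<close> above \<open>b\<close>.\<close>

definition attach :: "int \<Rightarrow> int \<Rightarrow> int set \<times> int set \<Rightarrow> int set \<times> int set" where
  "attach b x = (\<lambda>(U, D). if U \<noteq> {} \<and> Min U < b + N then (U, insert x D) else (insert x U, D))"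

definition detach :: "int set \<times> int set \<Rightarrow> int \<times> int set \<times> int set" where
  "detach = (\<lambda>(U, D). let x = Min (U \<union> D) in (x mod N, U - {x}, D - {x}))"

lemma lift_bounds:
  assumes "r \<in> P" "P \<subseteq> {0..<N}" "b mod N \<notin> P"
  shows "b < lift b r" "lift b r < b + N" "lift b r mod N = r"
proof -
  have "r \<in> {0..<N}" "b mod N \<noteq> r" using assms by auto
  then have "(r - b) mod N \<noteq> 0"
    by (metis atLeastLessThan_iff mod_eq_dvd_iff mod_pos_pos_trivial dvd_eq_mod_eq_0)
  moreover have "0 \<le> (r - b) mod N" using N_pos by simp
  ultimately show "b < lift b r" by (simp add: lift_def)
  show "lift b r < b + N" using N_pos by (simp add: lift_def)
  show "lift b r mod N = r" using \<open>r \<in> {0..<N}\<close> by (simp add: lift_def mod_simps)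
qed

lemma lift_unique: "b < x \<Longrightarrow> x < b + N \<Longrightarrow> lift b (x mod N) = x"
  by (simp add: lift_def mod_simps)

lemma windows_odd_insert_below:
  assumes "\<And>d. d \<in> D \<Longrightarrow> x < d"
  shows "windows_odd (insert x U) D \<longleftrightarrow> windows_odd U D"
proof -
  have "insert x U \<inter> {d<..<d + N} = U \<inter> {d<..<d + N}" if "d \<in> D" for d
    using assms[OF that] by auto
  then show ?thesis by (simp add: windows_odd_def)
qed

lemma configs_no_U:
  assumes "({}, D) \<in> configs b P"
  shows "D = {}"
  using assms by (auto simp: configs_def windows_odd_def)

text \<open>Above the base \<open>x\<close>, only \<open>Min U\<close> lies below
  \<open>x + N\<close>. If it is even below \<open>b + N\<close>, the window of a decorated
  \<open>x\<close> holds this one value, and the other values of \<open>U\<close> stay above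
  \<open>b + N\<close>. Otherwise \<open>x\<close> becomes the minimum of \<open>U\<close> and
  \<open>gaps_odd_insert\<close> applies; the windows of \<open>D\<close> start above
  \<open>x\<close> and do not change.\<close>

lemma attach_in_configs:
  assumes r: "r \<in> P" and P: "P \<subseteq> {0..<N}" "b mod N \<notin> P"
    and c: "(U, D) \<in> configs (lift b r) (P - {r})"
  shows "attach b (lift b r) (U, D) \<in> configs b P"
    and "detach (attach b (lift b r) (U, D)) = (r, U, D)"
proof -
  define x where "x = lift b r"
  have x: "b < x" "x < b + N" "x mod N = r"
    using lift_bounds[OF r P] by (simp_all add: x_def)
  have fin: "finite U" "finite D" and disj: "U \<inter> D = {}"
    and inj: "inj_on (\<lambda>x. x mod N) (U \<union> D)" and im: "(\<lambda>x. x mod N) ` (U \<union> D) = P - {r}"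
    and gt: "\<And>y. y \<in> U \<union> D \<Longrightarrow> x < y"
    and ok: "gaps_odd x U" "windows_odd U D"
    using c by (auto simp: configs_def x_def)
  have notin: "x \<notin> U" "x \<notin> D" using gt by auto
  have Min: "Min (insert x (U \<union> D)) = x"
    by (rule Min_eqI) (use fin gt in \<open>auto intro: less_imp_le\<close>)
  have inj': "inj_on (\<lambda>x. x mod N) (insert x (U \<union> D))"
    using inj im x notin by auto
  have im': "(\<lambda>x. x mod N) ` (insert x (U \<union> D)) = P"
    using im x r by auto
  show "attach b (lift b r) (U, D) \<in> configs b P"
  proof (cases "U \<noteq> {} \<and> Min U < b + N")
    case True
    have b: "b < v" if "v \<in> U" for v using that gt[of v] x(1) by auto
    have m: "Min U \<in> U" "\<forall>v\<in>U - {Min U}. x + N \<le> v" "gaps_odd (Min U) (U - {Min U})" "Min U < x + N"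
      using ok(1) gaps_odd_Min[of U x] True fin gt by (auto simp del: Min_less_iff)
    have "gaps_odd b U"
      by (subst gaps_odd_Min[OF fin(1) _ b]) (use True m x in force)+
    moreover have "U \<inter> {x<..<x + N} = {Min U}"
      using m gt[of "Min U"] by (auto simp del: Min_less_iff Min_gr_iff) (metis DiffI empty_iff insert_iff not_less)+
    then have "windows_odd U (insert x D)"
      using ok(2) by (simp add: windows_odd_def)
    ultimately show ?thesis
      using True fin disj inj' im' gt x notin
      by (auto simp: attach_def configs_def x_def[symmetric] simp del: Min_less_iff image_insert inj_on_insert)
         (meson UnCI order.strict_trans)+
  next
    case False
    have "b + N \<le> v" if "v \<in> U" for v
      using that False fin by (meson Min_le empty_iff le_less_trans not_less)
    then have "gaps_odd b (insert x U)"
      using gaps_odd_insert[of U x b] fin gt x ok by auto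
    moreover have "windows_odd (insert x U) D"
      using windows_odd_insert_below[of D x U] ok gt by auto
    ultimately show ?thesis
      using False fin disj inj' im' gt x notin
      by (auto simp: attach_def configs_def x_def[symmetric] simp del: Min_less_iff image_insert inj_on_insert)
         (meson UnCI order.strict_trans)+
  qed
  show "detach (attach b (lift b r) (U, D)) = (r, U, D)"
    using Min notin x by (auto simp: attach_def detach_def Let_def x_def[symmetric])
qed

text \<open>The bottom value \<open>x\<close> is below \<open>b + N\<close> because
  \<open>Min U\<close> is, so it is the lift of its residue. What remains shows which set it came
  from: if \<open>x\<close> was in \<open>U\<close>, the other undecorated values are at least
  \<open>b + N\<close>; if it was in \<open>D\<close>, the minimum of \<open>U\<close> is still
  below \<open>b + N\<close>.\<close>

lemma detach_in_configs:
  assumes P: "P \<noteq> {}" "P \<subseteq> {0..<N}" "b mod N \<notin> P" and c: "(U, D) \<in> configs b P"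
  shows "detach (U, D) \<in> (SIGMA r:P. configs (lift b r) (P - {r}))"
    and "(\<lambda>(r, c). attach b (lift b r) c) (detach (U, D)) = (U, D)"
proof -
  define x where "x = Min (U \<union> D)"
  have fin: "finite U" "finite D" and disj: "U \<inter> D = {}"
    and inj: "inj_on (\<lambda>x. x mod N) (U \<union> D)" and im: "(\<lambda>x. x mod N) ` (U \<union> D) = P"
    and gt: "\<And>y. y \<in> U \<union> D \<Longrightarrow> b < y"
    and ok: "gaps_odd b U" "windows_odd U D"
    using c by (auto simp: configs_def)
  have ne: "U \<union> D \<noteq> {}" using im P by auto
  then have U: "U \<noteq> {}" using configs_no_U c by auto
  define u where "u = Min U"
  have gapsU: "u < b + N" "\<And>v. v \<in> U \<Longrightarrow> v \<noteq> u \<Longrightarrow> b + N \<le> v" "gaps_odd u (U - {u})"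
    using gaps_odd_Min[of U b] fin U ok gt by (auto simp: u_def simp del: Min_less_iff)
  have uU: "u \<in> U" using fin U by (simp add: u_def)
  have xS: "x \<in> U \<union> D" and xmin: "\<And>y. y \<in> U \<union> D \<Longrightarrow> x \<le> y"
    using Min_in[of "U \<union> D"] Min_le[of "U \<union> D"] fin ne by (auto simp: x_def simp del: Min_in Min_le)
  have bx: "b < x" using gt xS by auto
  have xN: "x < b + N" using gapsU(1) xmin[of u] uU by auto
  have lift: "lift b (x mod N) = x" using lift_unique bx xN by auto
  have xP: "x mod N \<in> P" using im xS by auto
  have inj': "inj_on (\<lambda>x. x mod N) ((U - {x}) \<union> (D - {x}))"
    using inj by (rule inj_on_subset) auto
  have im': "(\<lambda>x. x mod N) ` ((U - {x}) \<union> (D - {x})) = P - {x mod N}"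
    unfolding Un_Diff[symmetric] im[symmetric]
    by (subst inj_on_image_set_diff[OF inj]) (use xS in auto)
  have gt': "x < y" if "y \<in> (U - {x}) \<union> (D - {x})" for y
    using that xmin[of y] by auto
  have wd: "windows_odd (U - {x}) (D - {x})"
  proof -
    have "windows_odd (U - {x}) (D - {x}) \<longleftrightarrow> windows_odd (insert x (U - {x})) (D - {x})"
      using windows_odd_insert_below[of "D - {x}" x "U - {x}"] gt' by auto
    moreover have "windows_odd U (D - {x})" using ok by (simp add: windows_odd_def)
    moreover have "x \<notin> U \<Longrightarrow> U - {x} = U" by auto
    ultimately show ?thesis using insert_absorb[of x U] by (metis insert_Diff_single)
  qed
  have main: "gaps_odd x (U - {x}) \<and> attach b x (U - {x}, D - {x}) = (U, D)"
  proof (cases "x \<in> U")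
    case True
    then have "u \<le> x" using fin by (simp add: u_def)
    then have "x = u" using xmin[of u] uU by simp
    moreover have "\<not> (U - {x} \<noteq> {} \<and> Min (U - {x}) < b + N)"
    proof
      assume a: "U - {x} \<noteq> {} \<and> Min (U - {x}) < b + N"
      then have "Min (U - {x}) \<in> U - {x}" using fin by (intro Min_in) auto
      then show False using a gapsU(2)[of "Min (U - {x})"] \<open>x = u\<close> by (auto simp del: Min_less_iff)
    qed
    ultimately show ?thesis using gapsU True disj by (auto simp: attach_def simp del: Min_less_iff)
  next
    case False
    then have xD: "x \<in> D" using xS by auto
    have xu: "x < u" using xmin[of u] uU False by (cases "x = u") auto
    \<comment> \<open>If the second smallest value \<open>v'\<close> of \<open>U\<close> were also
      below \<open>x + N\<close>, the window above \<open>x\<close> would hold exactly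
      \<open>u\<close> and \<open>v'\<close>, any further value being at least \<open>u + N\<close>.
      This even count contradicts \<open>windows_odd\<close>.\<close>
    have "x + N \<le> v" if v: "v \<in> U" "v \<noteq> u" for v
    proof (rule ccontr)
      assume "\<not> x + N \<le> v"
      define V where "V = U - {u}"
      define v' where "v' = Min V"
      have V: "finite V" "V \<noteq> {}" using fin v by (auto simp: V_def)
      have Vu: "u < y" if "y \<in> V" for y
        using that fin by (simp add: V_def u_def order.not_eq_order_implies_strict)
      have v'V: "v' \<in> V" using V by (simp add: v'_def)
      have v'v: "v' \<le> v" using V v by (simp add: v'_def V_def)
      have "u + N \<le> y" if "y \<in> V" "y \<noteq> v'" for y
        using gaps_odd_Min[of V u] V Vu gapsU(3) that by (auto simp: v'_def V_def)
      then have "U \<inter> {x<..<x + N} = {u, v'}"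
        using xu uU v'V gapsU(1) v'v Vu[OF v'V] bx \<open>\<not> x + N \<le> v\<close> by (auto simp: V_def) force
      moreover have "u \<noteq> v'" using Vu v'V by blast
      ultimately have "even (card (U \<inter> {x<..<x + N}))" by simp
      then show False using ok xD by (simp add: windows_odd_def)
    qed
    then have "gaps_odd x U"
      using gaps_odd_Min[of U x] gapsU fin U xu xmin bx False
      by (fastforce simp: u_def[symmetric] order.not_eq_order_implies_strict)
    then show ?thesis
      using False gapsU(1) U xD by (auto simp: attach_def u_def)
  qed
  show "detach (U, D) \<in> (SIGMA r:P. configs (lift b r) (P - {r}))"
    using fin disj inj' im' gt' wd main xP lift
    by (auto simp: detach_def x_def[symmetric] configs_def Let_def)
  show "(\<lambda>(r, c). attach b (lift b r) c) (detach (U, D)) = (U, D)"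
    using main lift by (simp add: detach_def x_def[symmetric] Let_def)
qed

text \<open>Iterating this bijection replaces a configuration by one choice of residue per value,
  which is how codes arise.\<close>

lemma bij_betw_attach:
  assumes "P \<noteq> {}" "P \<subseteq> {0..<N}" "b mod N \<notin> P"
  shows "bij_betw (\<lambda>(r, c). attach b (lift b r) c)
    (SIGMA r:P. configs (lift b r) (P - {r})) (configs b P)"
proof (rule bij_betw_byWitness[where f' = detach])
  let ?f = "\<lambda>(r, c). attach b (lift b r) c" and ?A = "SIGMA r:P. configs (lift b r) (P - {r})"
  have "detach (?f a) = a \<and> ?f a \<in> configs b P" if "a \<in> ?A" for a
  proof -
    obtain r U D where a: "a = (r, U, D)" by (cases a) auto
    with that have "r \<in> P" "(U, D) \<in> configs (lift b r) (P - {r})" by auto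
    then show ?thesis
      using attach_in_configs[OF _ assms(2,3), of r U D] by (simp add: a)
  qed
  then show "\<forall>a\<in>?A. detach (?f a) = a" and "?f ` ?A \<subseteq> configs b P"
    by blast+
  have "?f (detach a) = a \<and> detach a \<in> ?A" if "a \<in> configs b P" for a
  proof -
    obtain U D where a: "a = (U, D)" by (cases a) auto
    with that show ?thesis
      unfolding a using detach_in_configs[OF assms, of U D] by blast
  qed
  then show "\<forall>a\<in>configs b P. ?f (detach a) = a" and "detach ` configs b P \<subseteq> ?A"
    by blast+
qed

text \<open>For \<open>b = - N\<close>, the summand of \<open>x = N a - w\<close> is \<open>a\<close>, so that \<open>spread\<close> is the area.
  The slack is the number of residues in the arc from \<open>Min U\<close> (included) up to \<open>b\<close>. It matches \<^const>\<open>room\<close>.\<close>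

definition spread :: "int \<Rightarrow> int set \<Rightarrow> nat" where
  "spread b S = (\<Sum>x\<in>S. nat ((x - b) div N))"

definition slack :: "int \<Rightarrow> int set \<Rightarrow> int set \<Rightarrow> nat" where
  "slack b U S = (if U = {} then 0 else card {y\<in>S. (y - Min U) mod N < b + N - Min U})"

section \<open>Arcs of residues and the change of the statistics\<close>

lemma mod_shift:
  assumes "a \<le> b" "b \<le> a + N"
  shows "(y - b) mod N = (y - a) mod N - (b - a) + (if (y - a) mod N < b - a then N else 0)"
proof -
  have "0 \<le> (y - a) mod N" "(y - a) mod N < N" using N_pos by auto
  moreover have "y - b = (y - a) mod N - (b - a) + N * ((y - a) div N)"
    using mult_div_mod_eq[of N "y - a"] by linarith
  ultimately show ?thesis
    using assms
    by (intro int_mod_pos_eq[where q = "(y - a) div N - (if (y - a) mod N < b - a then 1 else 0)"])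
       (auto simp: right_diff_distrib)
qed

text \<open>\<open>(y - a) mod N\<close> is the distance from \<open>a\<close> up to the residue of
  \<open>y\<close> on a circle of length \<open>N\<close>, so these sets are arcs. The bound
  \<open>x \<le> a + N\<close> keeps the arc from overlapping itself.\<close>

lemma card_arc_split:
  assumes "finite S" "a \<le> b" "b \<le> x" "x \<le> a + N"
  shows "card {y\<in>S. (y - a) mod N < x - a} =
    card {y\<in>S. (y - a) mod N < b - a} + card {y\<in>S. (y - b) mod N < x - b}"
proof -
  have *: "(y - b) mod N < x - b \<longleftrightarrow> (y - a) mod N < x - a \<and> \<not> (y - a) mod N < b - a" for y
  proof -
    have "0 \<le> (y - a) mod N" using N_pos by simp
    then show ?thesis using mod_shift[of a b y] assms by (auto split: if_splits)
  qed
  have "{y\<in>S. (y - a) mod N < x - a} =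
      {y\<in>S. (y - a) mod N < b - a} \<union> {y\<in>S. (y - b) mod N < x - b}"
    using assms by (auto simp: *)
  then show ?thesis
    using assms(1) by (subst card_Un_disjoint[symmetric]) (auto simp: *)
qed

lemma mod_diff_period: "(y - (a - N)) mod N = (y - a) mod N"
proof -
  have "y - (a - N) = y - a + N" by simp
  then show ?thesis by (simp only: mod_add_self2)
qed

text \<open>Lowering the base from \<open>x\<close> to \<open>b\<close> raises the quotient of
  \<open>y\<close> by one exactly when the residue of \<open>y\<close> lies in the arc from
  \<open>b\<close> to \<open>x\<close>. The quotient of \<open>x\<close> itself is 0.\<close>

lemma spread_step:
  assumes "finite S" "\<And>y. y \<in> S \<Longrightarrow> x < y" "b < x" "x < b + N"
  shows "spread b (insert x S) = spread x S + card {y\<in>S. (y - b) mod N < x - b}"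
proof -
  have "nat ((y - b) div N) = nat ((y - x) div N) + of_bool ((y - b) mod N < x - b)" if "y \<in> S" for y
  proof -
    have "N * ((y - x) div N) = y - x - (y - x) mod N" "N * ((y - b) div N) = y - b - (y - b) mod N"
      by (simp_all add: minus_mod_eq_mult_div)
    then have "N * ((y - b) div N) = N * ((y - x) div N + of_bool ((y - b) mod N < x - b))"
      using mod_shift[of b x y] assms by (simp add: distrib_left)
    then have "(y - b) div N = (y - x) div N + of_bool ((y - b) mod N < x - b)"
      using N_pos by (metis mult_cancel_left order_less_irrefl)
    moreover have "0 \<le> (y - x) div N"
      using assms(2)[OF that] N_pos by (simp add: pos_imp_zdiv_nonneg_iff)
    ultimately show ?thesis by (simp add: nat_add_distrib)
  qed
  then have "spread b S = spread x S + card {y\<in>S. (y - b) mod N < x - b}"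
    using assms(1) by (simp add: spread_def sum.distrib of_bool_def sum.If_cases Int_def)
  moreover have "(x - b) div N = 0" using assms by simp
  moreover have "x \<notin> S" using assms by blast
  ultimately show ?thesis using assms(1) by (simp add: spread_def)
qed

text \<open>Two arcs ending at \<open>x\<close> are compared: \<open>e\<close> counts the one from
  \<open>b\<close>, the old slack the one from \<open>Min U - N\<close>. One contains the other, so
  \<open>e < slack\<close> decides whether \<open>Min U - N < b\<close>, which is the condition for
  decorating in \<open>attach\<close>.\<close>

lemma attach_statistics:
  assumes r: "r \<in> P" and P: "P \<subseteq> {0..<N}" "b mod N \<notin> P"
    and c: "(U, D) \<in> configs (lift b r) (P - {r})"
    and at: "attach b (lift b r) (U, D) = (U', D')"
    and e: "e = card {s\<in>P. (s - b) mod N < (r - b) mod N}"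
  shows "spread b (U' \<union> D') = spread (lift b r) (U \<union> D) + e"
    and "card D' = card D + of_bool (e < slack (lift b r) U (U \<union> D))"
    and "slack b U' (U' \<union> D') = (if e < slack (lift b r) U (U \<union> D)
      then slack (lift b r) U (U \<union> D) - e else card P - e)"
proof -
  define x where "x = lift b r"
  define S where "S = U \<union> D"
  have x: "b < x" "x < b + N" "x mod N = r"
    using lift_bounds[OF r P] by (simp_all add: x_def)
  have fin: "finite U" "finite D" and disj: "U \<inter> D = {}"
    and inj: "inj_on (\<lambda>x. x mod N) S" and im: "(\<lambda>x. x mod N) ` S = P - {r}"
    and gt: "\<And>y. y \<in> S \<Longrightarrow> x < y"
    and ok: "gaps_odd x U"
    using c by (auto simp: configs_def x_def S_def)
  have finS: "finite S" and US: "U \<subseteq> S" using fin by (auto simp: S_def)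
  have notin: "x \<notin> S" using gt by auto
  have S': "U' \<union> D' = insert x S"
    using at by (auto simp: attach_def S_def x_def split: if_splits)
  have "{s\<in>P. (s - b) mod N < (r - b) mod N} = (\<lambda>y. y mod N) ` {y\<in>S. (y - b) mod N < x - b}"
  proof -
    have "{s\<in>P. (s - b) mod N < (r - b) mod N} = {s\<in>P - {r}. (s - b) mod N < x - b}"
      by (auto simp: x_def lift_def)
    also have "\<dots> = (\<lambda>y. y mod N) ` {y\<in>S. (y mod N - b) mod N < x - b}"
      unfolding im[symmetric] by blast
    finally show ?thesis by (simp only: mod_diff_left_eq)
  qed
  then have e': "e = card {y\<in>S. (y - b) mod N < x - b}"
    unfolding e by (auto intro!: card_image inj_on_subset[OF inj])
  have card: "card P = Suc (card S)"
  proof -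
    have "card S = card (P - {r})" using card_image[OF inj] im by simp
    moreover have "finite P" using P(1) finite_subset by blast
    ultimately show ?thesis using r by (metis card_Suc_Diff1)
  qed
  show "spread b (U' \<union> D') = spread (lift b r) (U \<union> D) + e"
    using spread_step[OF finS gt x(1,2)] by (simp add: S' e' S_def[symmetric] x_def[symmetric])
  have step: "card D' = card D + of_bool (e < slack x U S) \<and>
    slack b U' (insert x S) = (if e < slack x U S then slack x U S - e else card P - e)"
  proof (cases "U = {}")
    case True
    then have "D = {}" using c configs_no_U by simp
    with True at have "U' = {x}" "D' = {}" "S = {}"
      by (auto simp: attach_def x_def S_def)
    moreover have "{y\<in>{x}. (y - x) mod N < b + N - x} = {x}" using x by auto
    ultimately show ?thesis using True \<open>D = {}\<close> card by (simp add: slack_def e')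
  next
    case False
    define u where "u = Min U"
    have u: "u \<in> S" "x < u" "u < x + N"
      using gaps_odd_Min[of U x] fin False ok gt US Min_in[of U] by (auto simp: u_def S_def simp del: Min_less_iff Min_gr_iff)
    have old: "slack x U S = card {y\<in>S. (y - (u - N)) mod N < x - (u - N)}"
      unfolding mod_diff_period unfolding diff_diff_eq2 using False by (simp add: slack_def u_def)
    show ?thesis
    proof (cases "u < b + N")
      case True
      then have UD: "U' = U" "D' = insert x D"
        using at False by (auto simp: attach_def u_def x_def)
      have new: "slack b U (insert x S) = card {y\<in>S. (y - (u - N)) mod N < b - (u - N)}"
      proof -
        have "(x - u) mod N = x - u + N"
          using u x by (intro int_mod_pos_eq[where q = "-1"]) auto
        then have "{y\<in>insert x S. (y - u) mod N < b + N - u} = {y\<in>S. (y - u) mod N < b + N - u}"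
          using x by auto
        then show ?thesis
          unfolding mod_diff_period unfolding diff_diff_eq2 using False by (simp add: slack_def u_def)
      qed
      \<comment> \<open>The value \<open>u\<close> itself lies at the start of this arc, so the new
        slack is positive and \<open>e\<close> is strictly below the old one.\<close>
      have "u \<in> {y\<in>S. (y - (u - N)) mod N < b - (u - N)}" using u True by simp
      then have "0 < card {y\<in>S. (y - (u - N)) mod N < b - (u - N)}"
        using finS by (auto simp: card_gt_0_iff)
      moreover have "slack x U S = slack b U (insert x S) + e"
        unfolding old new e' by (rule card_arc_split) (use finS u x True in auto)
      moreover have "card D' = card D + 1"
        using UD fin notin by (simp add: S_def)
      ultimately show ?thesis using new by (simp add: UD)
    next
      case nlt: False
      then have UD: "U' = insert x U" "D' = D"
        using at by (auto simp: attach_def u_def x_def)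
      have "e = card {y\<in>S. (y - b) mod N < (u - N) - b} + slack x U S"
        unfolding old e' by (rule card_arc_split) (use finS u x nlt in auto)
      then have "\<not> e < slack x U S" by simp
      \<comment> \<open>The minimum is now \<open>x\<close>. The arc from \<open>x - N\<close> to
        \<open>x\<close> is the whole circle; cutting off the part from \<open>b\<close> to
        \<open>x\<close>, which holds \<open>e\<close> values of \<open>S\<close>, leaves the arc up
        to \<open>b\<close>, and \<open>x\<close> adds one.\<close>
      moreover have "slack b U' (insert x S) = card P - e"
      proof -
        have "Min (insert x U) = x"
          by (rule Min_eqI) (use fin gt US in \<open>auto intro: less_imp_le\<close>)
        moreover have "{y\<in>insert x S. (y - x) mod N < b + N - x} = insert x {y\<in>S. (y - (x - N)) mod N < b - (x - N)}"
          unfolding mod_diff_period unfolding diff_diff_eq2 using x by auto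
        ultimately have "slack b U' (insert x S) = Suc (card {y\<in>S. (y - (x - N)) mod N < b - (x - N)})"
          using notin finS by (simp add: slack_def UD)
        moreover have "card {y\<in>S. (y - (x - N)) mod N < x - (x - N)} = card {y\<in>S. (y - (x - N)) mod N < b - (x - N)} + e"
          unfolding e' by (rule card_arc_split) (use finS x in auto)
        moreover have "{y\<in>S. (y - (x - N)) mod N < x - (x - N)} = S"
          using N_pos by auto
        ultimately show ?thesis using card by simp
      qed
      ultimately show ?thesis by (simp add: UD)
    qed
  qed
  then show "card D' = card D + of_bool (e < slack (lift b r) U (U \<union> D))"
    and "slack b U' (U' \<union> D') = (if e < slack (lift b r) U (U \<union> D)
      then slack (lift b r) U (U \<union> D) - e else card P - e)"
    by (simp_all add: S' x_def S_def)
qed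

lemma configs_empty: "configs b {} = {({}, {})}"
  by (auto simp: configs_def windows_odd_def)

lemma finite_configs:
  assumes "finite P" "P \<subseteq> {0..<N}" "b mod N \<notin> P"
  shows "finite (configs b P)"
  using assms
proof (induction "card P" arbitrary: b P)
  case 0
  then show ?case by (simp add: configs_empty)
next
  case (Suc n)
  then have ne: "P \<noteq> {}" by auto
  have "finite (configs (lift b r) (P - {r}))" if "r \<in> P" for r
  proof (rule Suc.hyps(1))
    have "lift b r mod N = r" using lift_bounds(3)[OF that Suc.prems(2,3)] by simp
    then show "lift b r mod N \<notin> P - {r}" by simp
  qed (use Suc that in auto)
  then have "finite (SIGMA r:P. configs (lift b r) (P - {r}))"
    using Suc.prems by blast
  then show ?case
    using bij_betw_finite[OF bij_betw_attach[OF ne Suc.prems(2,3)]] by blast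
qed

end

section \<open>Summation over configurations as summation over codes\<close>

lemma bij_betw_rank:
  fixes g :: "'a \<Rightarrow> 'b::linorder"
  assumes "finite P" "inj_on g P"
  shows "bij_betw (\<lambda>r. card {s\<in>P. g s < g r}) P {..<card P}"
proof -
  let ?rk = "\<lambda>r. card {s\<in>P. g s < g r}"
  have lt: "?rk r < ?rk r'" if "r \<in> P" "g r < g r'" for r r'
    by (rule psubset_card_mono) (use assms(1) that in auto)
  have inj: "inj_on ?rk P"
  proof (rule inj_onI)
    fix r r' assume "r \<in> P" "r' \<in> P" "?rk r = ?rk r'"
    then have "g r = g r'" using lt[of r r'] lt[of r' r]
      by (cases "g r" "g r'" rule: linorder_cases) auto
    then show "r = r'" using assms(2) \<open>r \<in> P\<close> \<open>r' \<in> P\<close> by (auto dest: inj_onD)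
  qed
  moreover have "?rk ` P \<subseteq> {..<card P}"
    using assms(1) by (auto intro!: psubset_card_mono)
  then have "?rk ` P = {..<card P}"
    using card_image[OF inj] by (intro card_subset_eq) auto
  ultimately show ?thesis by (simp add: bij_betw_def)
qed

context modulus
begin

text \<open>\<open>f\<close> also receives the slack because the next step compares its entry with
  it. The induction hypothesis is used for \<open>?G (e r)\<close>, which performs one step of the
  recursion before applying \<open>f\<close>.\<close>

lemma sum_configs:
  fixes f :: "nat \<Rightarrow> nat \<Rightarrow> nat \<Rightarrow> 'a::comm_monoid_add"
  assumes "finite P" "P \<subseteq> {0..<N}" "b mod N \<notin> P"
  shows "(\<Sum>(U, D)\<in>configs b P. f (spread b (U \<union> D)) (card D) (slack b U (U \<union> D))) =
    (\<Sum>es\<in>codes (card P). f (sum_list es) (mono_steps es) (room es))"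
  using assms
proof (induction "card P" arbitrary: b P f)
  case 0
  then show ?case by (simp add: configs_empty codes_0 spread_def slack_def)
next
  case (Suc n)
  define e where "e r = card {s\<in>P. (s - b) mod N < (r - b) mod N}" for r
  let ?F = "\<lambda>b (U, D). f (spread b (U \<union> D)) (card D) (slack b U (U \<union> D))"
  let ?G = "\<lambda>e a d k. f (a + e) (d + of_bool (e < k)) (if e < k then k - e else Suc n - e)"
  have ne: "P \<noteq> {}" using Suc.hyps(2) by auto
  have lift_notin: "lift b r mod N \<notin> P - {r}" if "r \<in> P" for r
    using lift_bounds(3)[OF that Suc.prems(2,3)] by simp
  have fin: "finite (configs (lift b r) (P - {r}))" if "r \<in> P" for r
    by (rule finite_configs) (use lift_notin that Suc.prems in auto)
  have "(\<Sum>c\<in>configs b P. ?F b c) =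
      (\<Sum>(r, c)\<in>(SIGMA r:P. configs (lift b r) (P - {r})). ?F b (attach b (lift b r) c))"
    by (subst sum.reindex_bij_betw[OF bij_betw_attach[OF ne Suc.prems(2,3)], symmetric])
       (simp add: split_def)
  also have "\<dots> = (\<Sum>r\<in>P. \<Sum>c\<in>configs (lift b r) (P - {r}). ?F b (attach b (lift b r) c))"
    using Suc.prems(1) fin by (subst sum.Sigma) auto
  also have "\<dots> = (\<Sum>r\<in>P. \<Sum>(U, D)\<in>configs (lift b r) (P - {r}).
      ?G (e r) (spread (lift b r) (U \<union> D)) (card D) (slack (lift b r) U (U \<union> D)))"
  proof (intro sum.cong refl, clarify)
    fix r U D assume "r \<in> P" "(U, D) \<in> configs (lift b r) (P - {r})"
    moreover obtain U' D' where "attach b (lift b r) (U, D) = (U', D')" by fastforce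
    ultimately show "?F b (attach b (lift b r) (U, D)) =
        ?G (e r) (spread (lift b r) (U \<union> D)) (card D) (slack (lift b r) U (U \<union> D))"
      using attach_statistics[OF _ Suc.prems(2,3), of r U D U' D' "e r"] Suc.hyps(2)
      by (simp add: e_def)
  qed
  also have "\<dots> = (\<Sum>r\<in>P. \<Sum>es\<in>codes n. ?G (e r) (sum_list es) (mono_steps es) (room es))"
  proof (rule sum.cong[OF refl])
    fix r assume r: "r \<in> P"
    have "n = card (P - {r})" using Suc.hyps(2) r by simp
    from Suc.hyps(1)[OF this _ _ lift_notin[OF r], of "?G (e r)"]
    show "(\<Sum>(U, D)\<in>configs (lift b r) (P - {r}).
        ?G (e r) (spread (lift b r) (U \<union> D)) (card D) (slack (lift b r) U (U \<union> D))) =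
      (\<Sum>es\<in>codes n. ?G (e r) (sum_list es) (mono_steps es) (room es))"
      using Suc.prems r \<open>n = card (P - {r})\<close> by auto
  qed
  also have "\<dots> = (\<Sum>r\<in>P. \<Sum>es\<in>codes n. f (sum_list (e r # es)) (mono_steps (e r # es)) (room (e r # es)))"
    by (intro sum.cong refl) (simp add: codes_def add.commute)
  also have "\<dots> = (\<Sum>e<card P. \<Sum>es\<in>codes n. f (sum_list (e # es)) (mono_steps (e # es)) (room (e # es)))"
  proof -
    \<comment> \<open>\<open>e r\<close> is the rank of \<open>r\<close> by distance above
      \<open>b\<close>. The distances are distinct, so \<open>e\<close> runs once through the
      numbers below \<open>card P\<close>: choosing a residue is choosing a code entry.\<close>
    have "inj_on (\<lambda>r. (r - b) mod N) P"
    proof (rule inj_onI)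
      fix r s assume "r \<in> P" "s \<in> P" "(r - b) mod N = (s - b) mod N"
      then have "r mod N = s mod N" by (metis diff_add_cancel mod_add_left_eq)
      then show "r = s" using \<open>r \<in> P\<close> \<open>s \<in> P\<close> Suc.prems(2)
        by (metis atLeastLessThan_iff mod_pos_pos_trivial subsetD)
    qed
    from bij_betw_rank[OF Suc.prems(1) this] have "bij_betw e P {..<card P}"
      by (simp add: e_def[abs_def])
    from sum.reindex_bij_betw[OF this] show ?thesis by simp
  qed
  also have "\<dots> = (\<Sum>es\<in>codes (card P). f (sum_list es) (mono_steps es) (room es))"
    unfolding Suc.hyps(2)[symmetric] sum_codes_Suc lessThan_Suc_atMost by simp
  finally show ?case .
qed

end

section \<open>Signed sums over orderings\<close>

definition orderings :: "'a set \<Rightarrow> 'a list set" where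
  "orderings A = {l. distinct l \<and> set l = A}"

lemma finite_orderings: "finite A \<Longrightarrow> finite (orderings A)"
  unfolding orderings_def
  by (rule finite_subset[OF _ finite_lists_length_eq[of A "card A"]]) (auto simp: distinct_card)

lemma sum_orderings_insert:
  fixes f :: "'a list \<Rightarrow> 'b::comm_monoid_add"
  assumes "finite A" "x \<notin> A"
  shows "(\<Sum>l\<in>orderings (insert x A). f l) =
    (\<Sum>l\<in>orderings A. \<Sum>i\<le>length l. f (take i l @ x # drop i l))"
proof -
  have "bij_betw (\<lambda>(l, i). take i l @ x # drop i l)
      (SIGMA l:orderings A. {..length l}) (orderings (insert x A))"
  \<comment> \<open>The inverse deletes \<open>x\<close> and records how many entries preceded
    it.\<close>
  proof (rule bij_betw_byWitness[where f' = "\<lambda>l. (remove1 x l, length (takeWhile (\<lambda>y. y \<noteq> x) l))"],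
      goal_cases)
    case 1
    have "remove1 x (take i l @ x # drop i l) = l \<and>
        length (takeWhile (\<lambda>y. y \<noteq> x) (take i l @ x # drop i l)) = i"
      if "l \<in> orderings A" "i \<le> length l" for l i
    proof -
      have "x \<notin> set (take i l)"
        using that assms(2) by (auto simp: orderings_def dest: in_set_takeD)
      then show ?thesis
        using that(2) by (simp add: remove1_append takeWhile_append2 min_def)
          (metis (mono_tags, lifting) takeWhile_append2 takeWhile.simps(2) append_Nil2 length_take min.absorb2)
    qed
    then show ?case by auto
  next
    case 2
    have "take (length (takeWhile (\<lambda>y. y \<noteq> x) l)) (remove1 x l) @
        x # drop (length (takeWhile (\<lambda>y. y \<noteq> x) l)) (remove1 x l) = l"
      if "l \<in> orderings (insert x A)" for l
    proof -
      have "x \<in> set l" using that by (auto simp: orderings_def)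
      then obtain l1 l2 where l: "l = l1 @ x # l2" "x \<notin> set l1" by (meson split_list_first)
      then have "takeWhile (\<lambda>y. y \<noteq> x) l = l1" by (auto simp: takeWhile_tail)
      then show ?thesis using l by (simp add: remove1_append)
    qed
    then show ?case by auto
  next
    case 3
    have "take i l @ x # drop i l \<in> orderings (insert x A)" if "l \<in> orderings A" for l i
    proof -
      have "distinct (take i l @ drop i l)" "set (take i l @ drop i l) = A" "x \<notin> set (take i l @ drop i l)"
        using that assms(2) by (simp_all add: orderings_def)
      then show ?thesis by (auto simp: orderings_def simp del: append_take_drop_id)
    qed
    then show ?case by auto
  next
    case 4
    have "remove1 x l \<in> orderings A \<and> length (takeWhile (\<lambda>y. y \<noteq> x) l) \<le> length (remove1 x l)"
      if "l \<in> orderings (insert x A)" for l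
    proof -
      have "x \<in> set l" using that by (auto simp: orderings_def)
      then obtain l1 l2 where l: "l = l1 @ x # l2" "x \<notin> set l1" by (meson split_list_first)
      then have "takeWhile (\<lambda>y. y \<noteq> x) l = l1" by (auto simp: takeWhile_tail)
      then show ?thesis using l that assms(2) by (auto simp: remove1_append orderings_def)
    qed
    then show ?case by auto
  qed
  from sum.reindex_bij_betw[OF this, of f, symmetric]
  have "(\<Sum>l\<in>orderings (insert x A). f l) =
      (\<Sum>(l, i)\<in>(SIGMA l:orderings A. {..length l}). f (take i l @ x # drop i l))"
    by (simp add: split_def)
  then show ?thesis
    using finite_orderings[OF assms(1)] by (simp add: sum.Sigma)
qed

context modulus
begin

text \<open>\<open>attacks U\<close> is \<^const>\<open>dinv\<close> without the correction for the number of decorations.\<close>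

fun attacks :: "int set \<Rightarrow> int list \<Rightarrow> nat" where
  "attacks U [] = 0"
| "attacks U (x # l) = of_bool (x \<in> U) * length (filter (\<lambda>y. x - N < y \<and> y < x) l) + attacks U l"

text \<open>The bound on the head treats \<open>b\<close> as its predecessor. For
  \<open>b = - N\<close> it reads \<open>hd l < 0\<close>, which for a path says that the first step
  has area 0.\<close>

definition admissible :: "int \<Rightarrow> int set \<Rightarrow> int list \<Rightarrow> bool" where
  "admissible b D l \<longleftrightarrow> successively (\<lambda>y x. x < y + N \<and> (x \<in> D \<longrightarrow> x < y)) l \<and>
     (l \<noteq> [] \<longrightarrow> hd l \<notin> D \<and> hd l < b + N)"

definition signed_sum :: "int \<Rightarrow> int set \<Rightarrow> int set \<Rightarrow> int" where
  "signed_sum b U D = (\<Sum>l\<in>orderings (U \<union> D). if admissible b D l then (- 1) ^ attacks U l else 0)"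

lemma attacks_insert:
  "attacks U (l1 @ x # l2) = attacks U (l1 @ l2)
     + of_bool (x \<in> U) * length (filter (\<lambda>y. x - N < y \<and> y < x) l2)
     + length (filter (\<lambda>y. y \<in> U \<and> x < y \<and> y < x + N) l1)"
  by (induction l1) auto

lemma attacks_cong: "(\<And>x. x \<in> set l \<Longrightarrow> x \<in> U \<longleftrightarrow> x \<in> V) \<Longrightarrow> attacks U l = attacks V l"
  by (induction l) auto

text \<open>A decorated value cannot follow \<open>x\<close>, since it would have to be smaller than
  \<open>x\<close>. Deleting \<open>x\<close> is harmless: \<open>hd l2 < x + N\<close> and
  \<open>x < last l1\<close> bound the new rise.\<close>

lemma admissible_insert_D:
  assumes "x \<notin> set (l1 @ l2)" "\<And>d. d \<in> D \<Longrightarrow> x < d"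
  shows "admissible b (insert x D) (l1 @ x # l2) \<longleftrightarrow> admissible b D (l1 @ l2) \<and>
    l1 \<noteq> [] \<and> x < last l1 \<and> (l2 \<noteq> [] \<longrightarrow> hd l2 \<notin> D \<and> hd l2 < x + N)"
proof -
  have cong: "successively (\<lambda>y z. z < y + N \<and> (z \<in> insert x D \<longrightarrow> z < y)) l \<longleftrightarrow>
      successively (\<lambda>y z. z < y + N \<and> (z \<in> D \<longrightarrow> z < y)) l" if "x \<notin> set l" for l
    by (rule successively_cong) (use that in auto)
  have "l2 \<noteq> [] \<Longrightarrow> hd l2 \<noteq> x" "l1 \<noteq> [] \<Longrightarrow> hd l1 \<noteq> x" using assms(1) by auto
  then show ?thesis
    using assms N_pos
    by (cases "l1 = []"; cases "l2 = []")
       (auto simp: admissible_def successively_Cons successively_append_iff cong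
          simp del: insert_iff, auto dest: assms(2))
qed

text \<open>Only the rise to the largest value is restricted; anything may follow it. Deleting it is
  harmless because the next value is smaller.\<close>

lemma admissible_insert_U:
  assumes "\<And>u. u \<in> set (l1 @ l2) \<Longrightarrow> u < x"
  shows "admissible b {} (l1 @ x # l2) \<longleftrightarrow> admissible b {} (l1 @ l2) \<and>
    (if l1 = [] then x < b + N else x - N < last l1)"
proof -
  have "l2 \<noteq> [] \<Longrightarrow> hd l2 < x" using assms by auto
  then show ?thesis
    using N_pos by (cases "l1 = []"; cases "l2 = []")
       (auto simp: admissible_def successively_Cons successively_append_iff)
qed

lemma sum_splits_Cons:
  "(\<Sum>i\<le>length (a # l). f (take i (a # l)) (drop i (a # l))) =
    f [] (a # l) + (\<Sum>i\<le>length l. f (a # take i l) (drop i l))"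
  by (simp only: list.size add_0_right add_Suc_right sum.atMost_Suc_shift) simp

text \<open>A decorated \<open>x\<close> that lies below all other decorated values can only be inserted at the end of a
  run of decorated values, after some \<open>y > x\<close> and before some \<open>z < x + N\<close>. As the word never rises by
  \<open>N\<close> or more, exactly one such gap follows each element of \<open>U\<close> in the window above \<open>x\<close>, before the
  next such element. Hence the sum is alternating.\<close>

lemma decorated_gaps_after:
  assumes "successively (\<lambda>y x. x < y + N \<and> (x \<in> D \<longrightarrow> x < y)) (y # l)"
    and "x \<notin> set (y # l)" "x + N \<notin> set (y # l)" and "\<And>d. d \<in> D \<Longrightarrow> x < d"
    and "set l \<subseteq> U \<union> D" "U \<inter> D = {}"
  defines "mid \<equiv> \<lambda>z. z \<in> U \<and> x < z \<and> z < x + N"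
  shows "(\<Sum>i\<le>length l. if x < last (y # take i l) \<and> (drop i l \<noteq> [] \<longrightarrow> hd (drop i l) \<notin> D \<and> hd (drop i l) < x + N)
      then (- 1 :: int) ^ length (filter mid (take i l)) else 0) =
    (if x < y then of_bool (even (length (filter mid l))) else - of_bool (odd (length (filter mid l))))"
  using assms(1-3,5)
proof (induction l arbitrary: y)
  case Nil
  then show ?case by simp
next
  case (Cons z l)
  let ?f = "\<lambda>y l1 l2. if x < last (y # l1) \<and> (l2 \<noteq> [] \<longrightarrow> hd l2 \<notin> D \<and> hd l2 < x + N)
      then (- 1 :: int) ^ length (filter mid l1) else 0"
  have IH: "(\<Sum>i\<le>length l. ?f z (take i l) (drop i l)) =
      (if x < z then of_bool (even (length (filter mid l))) else - of_bool (odd (length (filter mid l))))"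
    by (rule Cons.IH) (use Cons.prems in \<open>auto simp: successively_Cons\<close>)
  have "(\<Sum>i\<le>length (z # l). ?f y (take i (z # l)) (drop i (z # l))) =
      ?f y [] (z # l) + (\<Sum>i\<le>length l. ?f y (z # take i l) (drop i l))"
    by (rule sum_splits_Cons)
  also have "(\<Sum>i\<le>length l. ?f y (z # take i l) (drop i l)) =
      (if mid z then - 1 else 1) * (\<Sum>i\<le>length l. ?f z (take i l) (drop i l))"
    unfolding sum_distrib_left by (rule sum.cong) auto
  finally have *: "(\<Sum>i\<le>length (z # l). ?f y (take i (z # l)) (drop i (z # l))) =
      ?f y [] (z # l) + (if mid z then - 1 else 1) *
      (if x < z then of_bool (even (length (filter mid l))) else - of_bool (odd (length (filter mid l))))"
    unfolding IH .
  have z: "z < y + N" "z \<in> D \<Longrightarrow> z < y" "z \<noteq> x" "y \<noteq> x" "z \<noteq> x + N" "z \<in> U \<union> D" "z \<in> D \<Longrightarrow> x < z"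
    using Cons.prems assms(4) by auto
  show ?case
    unfolding * using z assms(6) N_pos by (auto simp: mid_def)
qed

lemma decorated_gaps:
  assumes "admissible b D l" "x \<notin> set l" "x + N \<notin> set l" "b < x" "\<And>d. d \<in> D \<Longrightarrow> x < d"
    and "set l = U \<union> D" "U \<inter> D = {}" and "distinct l"
  shows "(\<Sum>i\<le>length l. if take i l \<noteq> [] \<and> x < last (take i l) \<and>
        (drop i l \<noteq> [] \<longrightarrow> hd (drop i l) \<notin> D \<and> hd (drop i l) < x + N)
      then (- 1 :: int) ^ length (filter (\<lambda>z. z \<in> U \<and> x < z \<and> z < x + N) (take i l)) else 0) =
    - of_bool (odd (card (U \<inter> {x<..<x + N})))"
proof -
  define mid where "mid = (\<lambda>z. z \<in> U \<and> x < z \<and> z < x + N)"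
  have "U \<inter> {x<..<x + N} = set (filter mid l)"
    using assms(6) by (auto simp: mid_def)
  then have card: "card (U \<inter> {x<..<x + N}) = length (filter mid l)"
    using assms(8) by (simp only: distinct_card distinct_filter)
  let ?f = "\<lambda>l1 l2. if l1 \<noteq> [] \<and> x < last l1 \<and> (l2 \<noteq> [] \<longrightarrow> hd l2 \<notin> D \<and> hd l2 < x + N)
      then (- 1 :: int) ^ length (filter mid l1) else 0"
  have "(\<Sum>i\<le>length l. ?f (take i l) (drop i l)) = - of_bool (odd (length (filter mid l)))"
  proof (cases l)
    case Nil
    then show ?thesis by simp
  next
    case (Cons y t)
    \<comment> \<open>As \<open>b < x\<close>, the head is an undecorated value either in the window
      above \<open>x\<close> or below \<open>x\<close>. In the first case it adds one to the window
      and flips the sign of the remaining sum; both cases give the same formula.\<close>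
    have y: "y \<in> U" "y < x + N" "y \<noteq> x"
      using assms Cons by (auto simp: admissible_def)
    have "(\<Sum>i\<le>length l. ?f (take i l) (drop i l)) = (\<Sum>i\<le>length t. ?f (y # take i t) (drop i t))"
      unfolding Cons sum_splits_Cons[of ?f] by simp
    also have "\<dots> = (if mid y then - 1 else 1) *
        (\<Sum>i\<le>length t. if x < last (y # take i t) \<and> (drop i t \<noteq> [] \<longrightarrow> hd (drop i t) \<notin> D \<and> hd (drop i t) < x + N)
          then (- 1) ^ length (filter mid (take i t)) else 0)"
      unfolding sum_distrib_left by (rule sum.cong) auto
    also have "(\<Sum>i\<le>length t. if x < last (y # take i t) \<and> (drop i t \<noteq> [] \<longrightarrow> hd (drop i t) \<notin> D \<and> hd (drop i t) < x + N)
          then (- 1 :: int) ^ length (filter mid (take i t)) else 0) =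
        (if x < y then of_bool (even (length (filter mid t))) else - of_bool (odd (length (filter mid t))))"
    proof -
      have "set t \<subseteq> U \<union> D" using assms(6) Cons by auto
      with assms(1-5,7) show ?thesis
        unfolding mid_def Cons admissible_def by (intro decorated_gaps_after) auto
    qed
    finally show ?thesis using y by (auto simp: Cons mid_def)
  qed
  then show ?thesis unfolding card by (simp only: mid_def)
qed

text \<open>A decorated \<open>x\<close> attacks nothing. The only new attacks come from the values
  of \<open>U\<close> in the window above \<open>x\<close> that precede it, so the sum over the
  positions of \<open>x\<close> is that of \<open>decorated_gaps\<close>.\<close>

lemma signed_sum_insert_D:
  assumes "finite U" "finite D" "x \<notin> U" "\<And>d. d \<in> D \<Longrightarrow> x < d" "x + N \<notin> U \<union> D" "b < x" "U \<inter> D = {}"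
  shows "signed_sum b U (insert x D) = - signed_sum b U D * of_bool (odd (card (U \<inter> {x<..<x + N})))"
proof -
  let ?ok = "\<lambda>l1 l2. l1 \<noteq> [] \<and> x < last l1 \<and> (l2 \<noteq> [] \<longrightarrow> hd l2 \<notin> D \<and> hd l2 < x + N)"
  let ?s = "\<lambda>l1. (- 1 :: int) ^ length (filter (\<lambda>z. z \<in> U \<and> x < z \<and> z < x + N) l1)"
  have x: "x \<notin> U \<union> D" using assms by auto
  have "signed_sum b U (insert x D) =
      (\<Sum>l\<in>orderings (U \<union> D). \<Sum>i\<le>length l. if admissible b (insert x D) (take i l @ x # drop i l)
        then (- 1) ^ attacks U (take i l @ x # drop i l) else 0)"
    using sum_orderings_insert[of "U \<union> D" x] assms(1,2) x by (simp add: signed_sum_def)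
  also have "\<dots> = (\<Sum>l\<in>orderings (U \<union> D). \<Sum>i\<le>length l.
      (if admissible b D l then (- 1) ^ attacks U l else 0) * (if ?ok (take i l) (drop i l) then ?s (take i l) else 0))"
  proof (intro sum.cong refl)
    fix l i assume "l \<in> orderings (U \<union> D)"
    then have "x \<notin> set (take i l @ drop i l)" using x by (simp add: orderings_def)
    from admissible_insert_D[OF this, of D b] assms(4)
    show "(if admissible b (insert x D) (take i l @ x # drop i l)
        then (- 1) ^ attacks U (take i l @ x # drop i l) else 0) =
      (if admissible b D l then (- 1) ^ attacks U l else 0) * (if ?ok (take i l) (drop i l) then ?s (take i l) else 0)"
      using assms(3) by (auto simp: attacks_insert power_add)
  qed
  also have "\<dots> = (\<Sum>l\<in>orderings (U \<union> D). (if admissible b D l then (- 1) ^ attacks U l else 0) *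
      (- of_bool (odd (card (U \<inter> {x<..<x + N})))))"
  proof (rule sum.cong[OF refl])
    fix l assume l: "l \<in> orderings (U \<union> D)"
    show "(\<Sum>i\<le>length l. (if admissible b D l then (- 1) ^ attacks U l else 0) *
        (if ?ok (take i l) (drop i l) then ?s (take i l) else 0)) =
      (if admissible b D l then (- 1) ^ attacks U l else 0) * (- of_bool (odd (card (U \<inter> {x<..<x + N}))))"
      unfolding sum_distrib_left[symmetric]
      using decorated_gaps[of b D l x U] l assms x by (auto simp: orderings_def)
  qed
  finally show ?thesis unfolding signed_sum_def sum_distrib_right[symmetric] by simp
qed

text \<open>The gaps that count are those directly after an entry above \<open>c\<close>. For
  \<open>m\<close> such entries the exponents are \<open>m - 1, ..., 0\<close>, so the signs cancel
  in pairs and leave 1 iff \<open>m\<close> is odd.\<close>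

lemma undecorated_gaps_after:
  "(\<Sum>i\<le>length l. if c < last (y # take i l) then (- 1 :: int) ^ length (filter ((<) c) (drop i l)) else 0) =
    of_bool (odd (length (filter ((<) c) (y # l))))"
proof (induction l arbitrary: y)
  case (Cons z l)
  let ?f = "\<lambda>y l1 l2. if c < last (y # l1) then (- 1 :: int) ^ length (filter ((<) c) l2) else 0"
  have "(\<Sum>i\<le>length (z # l). ?f y (take i (z # l)) (drop i (z # l))) =
      ?f y [] (z # l) + (\<Sum>i\<le>length l. ?f y (z # take i l) (drop i l))"
    by (rule sum_splits_Cons)
  also have "(\<Sum>i\<le>length l. ?f y (z # take i l) (drop i l)) = (\<Sum>i\<le>length l. ?f z (take i l) (drop i l))"
    by simp
  also have "\<dots> = of_bool (odd (length (filter ((<) c) (z # l))))"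
    by (rule Cons.IH)
  finally show ?case by simp
qed simp

text \<open>The largest value \<open>x\<close> is attacked by nothing and attacks the later entries
  above \<open>x - N\<close>. The front, open iff \<open>x < b + N\<close>, adds one more term to
  the alternating sum of \<open>undecorated_gaps_after\<close>.\<close>

lemma signed_sum_insert_U:
  assumes "finite U" "\<And>u. u \<in> U \<Longrightarrow> u < x"
  shows "signed_sum b (insert x U) {} =
    signed_sum b U {} * of_bool (odd (card (U \<inter> {x - N<..<x}) + of_bool (x < b + N)))"
proof -
  let ?ok = "\<lambda>l1. if l1 = [] then x < b + N else x - N < last l1"
  let ?s = "\<lambda>l2. (- 1 :: int) ^ length (filter ((<) (x - N)) l2)"
  have x: "x \<notin> U" using assms(2) by blast
  have "signed_sum b (insert x U) {} =
      (\<Sum>l\<in>orderings U. \<Sum>i\<le>length l. if admissible b {} (take i l @ x # drop i l)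
        then (- 1) ^ attacks (insert x U) (take i l @ x # drop i l) else 0)"
    using sum_orderings_insert[of U x] assms(1) x by (simp add: signed_sum_def)
  also have "\<dots> = (\<Sum>l\<in>orderings U. \<Sum>i\<le>length l.
      (if admissible b {} l then (- 1) ^ attacks U l else 0) * (if ?ok (take i l) then ?s (drop i l) else 0))"
  proof (intro sum.cong refl)
    fix l i assume l: "l \<in> orderings U"
    then have lt: "u < x" if "u \<in> set (take i l @ drop i l)" for u
      using assms(2) that by (simp add: orderings_def)
    have "filter (\<lambda>y. y \<in> insert x U \<and> x < y \<and> y < x + N) (take i l) = []"
      using lt unfolding filter_empty_conv set_append by (meson UnI1 order.asym)
    moreover have "filter (\<lambda>y. x - N < y \<and> y < x) (drop i l) = filter ((<) (x - N)) (drop i l)"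
      using lt by (intro filter_cong) (auto dest: in_set_dropD)
    moreover have "attacks (insert x U) l = attacks U l"
      by (rule attacks_cong) (use l x in \<open>auto simp: orderings_def\<close>)
    ultimately have "attacks (insert x U) (take i l @ x # drop i l) =
        attacks U l + length (filter ((<) (x - N)) (drop i l))"
      by (simp only: attacks_insert append_take_drop_id) simp
    then show "(if admissible b {} (take i l @ x # drop i l)
        then (- 1) ^ attacks (insert x U) (take i l @ x # drop i l) else 0) =
      (if admissible b {} l then (- 1) ^ attacks U l else 0) * (if ?ok (take i l) then ?s (drop i l) else 0)"
      using admissible_insert_U[of "take i l" "drop i l" x b] lt by (auto simp: power_add)
  qed
  also have "\<dots> = (\<Sum>l\<in>orderings U. (if admissible b {} l then (- 1) ^ attacks U l else 0) *
      of_bool (odd (card (U \<inter> {x - N<..<x}) + of_bool (x < b + N))))"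
  proof (rule sum.cong[OF refl])
    fix l assume l: "l \<in> orderings U"
    have "U \<inter> {x - N<..<x} = set (filter ((<) (x - N)) l)"
      using l assms(2) by (auto simp: orderings_def)
    then have card: "card (U \<inter> {x - N<..<x}) = length (filter ((<) (x - N)) l)"
      using l by (simp only: distinct_card distinct_filter orderings_def mem_Collect_eq)
    have "(\<Sum>i\<le>length l. if ?ok (take i l) then ?s (drop i l) else 0) =
        of_bool (odd (length (filter ((<) (x - N)) l) + of_bool (x < b + N)))"
    proof (cases l)
      case (Cons y t)
      show ?thesis
        unfolding Cons sum_splits_Cons[of "\<lambda>l1 l2. if ?ok l1 then ?s l2 else 0"]
        using undecorated_gaps_after[of "x - N" y t] by simp
    qed simp
    then show "(\<Sum>i\<le>length l. (if admissible b {} l then (- 1) ^ attacks U l else 0) *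
        (if ?ok (take i l) then ?s (drop i l) else 0)) =
      (if admissible b {} l then (- 1) ^ attacks U l else 0) *
        of_bool (odd (card (U \<inter> {x - N<..<x}) + of_bool (x < b + N)))"
      unfolding sum_distrib_left[symmetric] card by simp
  qed
  finally show ?thesis unfolding signed_sum_def sum_distrib_right[symmetric] by simp
qed

text \<open>A larger value never enters the windows of smaller ones, so the parity factors collected
  on the way up are final.\<close>

lemma signed_sum_no_D:
  assumes "finite U"
  shows "signed_sum b U {} = of_bool (gaps_odd b U)"
  using assms
proof (induction U rule: finite_linorder_max_induct)
  case empty
  have "orderings ({} :: int set) = {[]}" by (auto simp: orderings_def)
  then show ?case by (simp add: signed_sum_def admissible_def)
next
  case (insert x U)
  have "insert x U \<inter> {u - N<..<u} = U \<inter> {u - N<..<u}" if "u \<in> insert x U" for u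
    using insert.hyps that by auto
  then have "gaps_odd b (insert x U) \<longleftrightarrow> gaps_odd b U \<and> odd (card (U \<inter> {x - N<..<x}) + of_bool (x < b + N))"
    by (auto simp: gaps_odd_def)
  then show ?case
    using signed_sum_insert_U[of U x b] insert by simp
qed

text \<open>Each decorated value, added from the largest down, brings a factor \<open>- 1\<close>;
  the term \<open>- card dv\<close> of \<open>dinv\<close> will cancel this sign. Distinct residues
  rule out the value \<open>x + N\<close>.\<close>

lemma signed_sum_eq:
  assumes "finite U" "finite D" "U \<inter> D = {}" "inj_on (\<lambda>x. x mod N) (U \<union> D)" "\<And>d. d \<in> D \<Longrightarrow> b < d"
  shows "signed_sum b U D = (- 1) ^ card D * of_bool (gaps_odd b U \<and> windows_odd U D)"
  using assms(2-5)
proof (induction D rule: finite_linorder_min_induct)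
  case empty
  then show ?case using signed_sum_no_D[OF assms(1)] by (simp add: windows_odd_def)
next
  case (insert x D)
  have x: "x \<notin> D" using insert.hyps by blast
  have "x + N \<notin> U \<union> D"
  proof
    assume "x + N \<in> U \<union> D"
    then show False
      using inj_onD[OF insert.prems(2), of x "x + N"] N_pos by auto
  qed
  then have "signed_sum b U (insert x D) = - signed_sum b U D * of_bool (odd (card (U \<inter> {x<..<x + N})))"
    by (intro signed_sum_insert_D) (use insert assms(1) in auto)
  moreover have "signed_sum b U D = (- 1) ^ card D * of_bool (gaps_odd b U \<and> windows_odd U D)"
    by (rule insert.IH) (use insert.prems in \<open>auto intro: inj_on_subset\<close>)
  moreover have "windows_odd U (insert x D) \<longleftrightarrow> odd (card (U \<inter> {x<..<x + N})) \<and> windows_odd U D"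
    by (simp add: windows_odd_def)
  ultimately show ?case
    using x insert.hyps(1) by (simp add: of_bool_conj)
qed

end

section \<open>The code of a permutation\<close>

definition ascends :: "(nat \<Rightarrow> nat) \<Rightarrow> nat \<Rightarrow> bool" where
  "ascends \<sigma> j \<longleftrightarrow> \<sigma> (j - 1) < \<sigma> j"

definition inv_at :: "(nat \<Rightarrow> nat) \<Rightarrow> nat \<Rightarrow> nat" where
  "inv_at \<sigma> j = card {i\<in>{1..<j}.
     if ascends \<sigma> (j - 1)
     then if ascends \<sigma> j then \<sigma> (j - 1) < \<sigma> i \<and> \<sigma> i < \<sigma> j else \<sigma> j < \<sigma> i
     else if ascends \<sigma> j then \<sigma> i < \<sigma> j else \<sigma> j < \<sigma> i \<and> \<sigma> i < \<sigma> (j - 1)}"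

text \<open>Counts the earlier values still ahead in the current direction, plus one: the number of
  ways to continue in that direction. This is \<open>room\<close> seen on the permutation.\<close>

definition reach :: "(nat \<Rightarrow> nat) \<Rightarrow> nat \<Rightarrow> nat" where
  "reach \<sigma> j = Suc (card {i\<in>{1..<j}. if ascends \<sigma> j then \<sigma> j < \<sigma> i else \<sigma> i < \<sigma> j})"

primrec perm_code :: "(nat \<Rightarrow> nat) \<Rightarrow> nat \<Rightarrow> nat list" where
  "perm_code \<sigma> 0 = []"
| "perm_code \<sigma> (Suc n) = inv_at \<sigma> (Suc n) # perm_code \<sigma> n"

lemma length_perm_code [simp]: "length (perm_code \<sigma> n) = n"
  by (induction n) auto

lemma inv_at_le: "inv_at \<sigma> (Suc m) \<le> m"
proof -
  have "inv_at \<sigma> (Suc m) \<le> card {1..<Suc m}"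
    unfolding inv_at_def by (rule card_mono) auto
  then show ?thesis by simp
qed

lemma perm_code_in_codes: "perm_code \<sigma> n \<in> codes n"
  by (induction n) (auto simp: codes_0 codes_Suc inv_at_le)

text \<open>The next two lemmas are used for \<open>\<tau> = \<sigma>\<close> after an ascent and for \<open>\<tau> = - \<sigma>\<close> after a descent.\<close>

lemma card_continue:
  fixes \<tau> :: "nat \<Rightarrow> int"
  assumes "\<tau> m < \<tau> (Suc m)" "inj_on \<tau> {1..Suc m}"
  shows "card {i\<in>{1..<m}. \<tau> m < \<tau> i} =
    card {i\<in>{1..<Suc m}. \<tau> m < \<tau> i \<and> \<tau> i < \<tau> (Suc m)} + card {i\<in>{1..<Suc m}. \<tau> (Suc m) < \<tau> i}"
proof -
  have ne: "\<tau> i \<noteq> \<tau> (Suc m)" if "i \<in> {1..<Suc m}" for i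
    using inj_onD[OF assms(2), of i "Suc m"] that by auto
  have eq: "{i\<in>{1..<m}. \<tau> m < \<tau> i} =
      {i\<in>{1..<Suc m}. \<tau> m < \<tau> i \<and> \<tau> i < \<tau> (Suc m)} \<union> {i\<in>{1..<Suc m}. \<tau> (Suc m) < \<tau> i}"
    (is "?L = ?R")
  proof (intro equalityI subsetI)
    fix i assume i: "i \<in> ?L"
    then have "\<tau> i < \<tau> (Suc m) \<or> \<tau> (Suc m) < \<tau> i" using ne[of i] by auto
    then show "i \<in> ?R" using i by auto
  next
    fix i assume i: "i \<in> ?R"
    then have "\<tau> m < \<tau> i" using assms(1) by auto
    moreover from this have "i \<noteq> m" by blast
    ultimately show "i \<in> ?L" using i by auto
  qed
  show ?thesis unfolding eq by (rule card_Un_disjoint) auto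
qed

lemma card_reverse:
  fixes \<tau> :: "nat \<Rightarrow> int"
  assumes "\<tau> (Suc m) < \<tau> m" "inj_on \<tau> {1..Suc m}" "1 \<le> m"
  shows "card {i\<in>{1..<m}. \<tau> m < \<tau> i} < card {i\<in>{1..<Suc m}. \<tau> (Suc m) < \<tau> i}"
    and "card {i\<in>{1..<Suc m}. \<tau> (Suc m) < \<tau> i} + card {i\<in>{1..<Suc m}. \<tau> i < \<tau> (Suc m)} = m"
proof -
  have ne: "\<tau> i \<noteq> \<tau> (Suc m)" if "i \<in> {1..<Suc m}" for i
    using inj_onD[OF assms(2), of i "Suc m"] that by auto
  have "m \<in> {i\<in>{1..<Suc m}. \<tau> (Suc m) < \<tau> i}" "m \<notin> {i\<in>{1..<m}. \<tau> m < \<tau> i}"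
    using assms by auto
  then show "card {i\<in>{1..<m}. \<tau> m < \<tau> i} < card {i\<in>{1..<Suc m}. \<tau> (Suc m) < \<tau> i}"
    using assms(1) by (intro psubset_card_mono psubsetI) auto
  have "{1..<Suc m} = {i\<in>{1..<Suc m}. \<tau> (Suc m) < \<tau> i} \<union> {i\<in>{1..<Suc m}. \<tau> i < \<tau> (Suc m)}"
    unfolding set_eq_iff Un_iff mem_Collect_eq using ne linorder_neqE by blast
  then have "m = card ({i\<in>{1..<Suc m}. \<tau> (Suc m) < \<tau> i} \<union> {i\<in>{1..<Suc m}. \<tau> i < \<tau> (Suc m)})"
    by (metis card_atLeastLessThan diff_Suc_1)
  then show "card {i\<in>{1..<Suc m}. \<tau> (Suc m) < \<tau> i} + card {i\<in>{1..<Suc m}. \<tau> i < \<tau> (Suc m)} = m"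
    by (subst (asm) card_Un_disjoint) auto
qed

text \<open>If the direction is kept, \<open>inv_at\<close> counts the values passed over, and
  \<open>reach\<close> drops by that number. If it is reversed, \<open>inv_at\<close> counts
  \<open>\<sigma> m\<close>, everything that was ahead of it and whatever the step passes, hence at
  least \<open>reach \<sigma> m\<close>; the remaining earlier values are ahead in the new
  direction.\<close>

lemma reach_Suc:
  assumes "1 \<le> m" "inj_on \<sigma> {1..Suc m}"
  shows "(ascends \<sigma> (Suc m) \<longleftrightarrow> ascends \<sigma> m) \<longleftrightarrow> inv_at \<sigma> (Suc m) < reach \<sigma> m"
    and "reach \<sigma> (Suc m) = (if inv_at \<sigma> (Suc m) < reach \<sigma> m
      then reach \<sigma> m - inv_at \<sigma> (Suc m) else Suc m - inv_at \<sigma> (Suc m))"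
proof -
  have inj: "inj_on (\<lambda>i. int (\<sigma> i)) {1..Suc m}" "inj_on (\<lambda>i. - int (\<sigma> i)) {1..Suc m}"
    using assms(2) by (auto simp: inj_on_def)
  have "\<sigma> m \<noteq> \<sigma> (Suc m)" using inj_onD[OF assms(2), of m "Suc m"] assms(1) by auto
  then consider "\<sigma> m < \<sigma> (Suc m)" "ascends \<sigma> (Suc m)" | "\<sigma> (Suc m) < \<sigma> m" "\<not> ascends \<sigma> (Suc m)"
    by (cases "\<sigma> m" "\<sigma> (Suc m)" rule: linorder_cases) (auto simp: ascends_def)
  then have "((ascends \<sigma> (Suc m) \<longleftrightarrow> ascends \<sigma> m) \<longleftrightarrow> inv_at \<sigma> (Suc m) < reach \<sigma> m) \<and>
    reach \<sigma> (Suc m) = (if inv_at \<sigma> (Suc m) < reach \<sigma> m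
      then reach \<sigma> m - inv_at \<sigma> (Suc m) else Suc m - inv_at \<sigma> (Suc m))"
  proof cases
    case 1
    show ?thesis
    proof (cases "ascends \<sigma> m")
      case True
      then show ?thesis
        using 1 card_continue[of "\<lambda>i. int (\<sigma> i)" m] inj by (simp add: inv_at_def reach_def)
    next
      case False
      then show ?thesis
        using 1 card_reverse[of "\<lambda>i. - int (\<sigma> i)" m] inj assms(1) by (simp add: inv_at_def reach_def)
    qed
  next
    case 2
    show ?thesis
    proof (cases "ascends \<sigma> m")
      case True
      then show ?thesis
        using 2 card_reverse[of "\<lambda>i. int (\<sigma> i)" m] inj assms(1) by (simp add: inv_at_def reach_def)
    next
      case False
      then show ?thesis
        using 2 card_continue[of "\<lambda>i. - int (\<sigma> i)" m] inj by (simp add: inv_at_def reach_def conj_commute)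
    qed
  qed
  then show "(ascends \<sigma> (Suc m) \<longleftrightarrow> ascends \<sigma> m) \<longleftrightarrow> inv_at \<sigma> (Suc m) < reach \<sigma> m"
    and "reach \<sigma> (Suc m) = (if inv_at \<sigma> (Suc m) < reach \<sigma> m
      then reach \<sigma> m - inv_at \<sigma> (Suc m) else Suc m - inv_at \<sigma> (Suc m))"
    by blast+
qed

lemma room_perm_code:
  assumes "inj_on \<sigma> {1..n}" "1 \<le> n"
  shows "room (perm_code \<sigma> n) = reach \<sigma> n"
  using assms
proof (induction n)
  case (Suc m)
  show ?case
  proof (cases "m = 0")
    case True
    then show ?thesis by (simp add: inv_at_def reach_def)
  next
    case False
    then have "room (perm_code \<sigma> m) = reach \<sigma> m"
      using Suc by (intro Suc.IH) (auto intro: inj_on_subset)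
    then show ?thesis
      using reach_Suc(2)[of m \<sigma>] Suc.prems False by simp
  qed
qed simp

lemma mono_steps_perm_code:
  assumes "inj_on \<sigma> {1..n}"
  shows "mono_steps (perm_code \<sigma> n) = card {j\<in>{2..n}. ascends \<sigma> j \<longleftrightarrow> ascends \<sigma> (j - 1)}"
  using assms
proof (induction n)
  case (Suc m)
  show ?case
  proof (cases "m = 0")
    case True
    then show ?thesis by (simp add: inv_at_def)
  next
    case False
    have inj: "inj_on \<sigma> {1..m}" by (rule inj_on_subset[OF Suc.prems]) auto
    have "{j\<in>{2..Suc m}. ascends \<sigma> j \<longleftrightarrow> ascends \<sigma> (j - 1)} =
        (if ascends \<sigma> (Suc m) \<longleftrightarrow> ascends \<sigma> m then {Suc m} else {}) \<union>
        {j\<in>{2..m}. ascends \<sigma> j \<longleftrightarrow> ascends \<sigma> (j - 1)}"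
      using False by (auto simp: le_Suc_eq)
    then have "card {j\<in>{2..Suc m}. ascends \<sigma> j \<longleftrightarrow> ascends \<sigma> (j - 1)} =
        card {j\<in>{2..m}. ascends \<sigma> j \<longleftrightarrow> ascends \<sigma> (j - 1)} + of_bool (ascends \<sigma> (Suc m) \<longleftrightarrow> ascends \<sigma> m)"
      by auto
    then show ?thesis
      using Suc.IH[OF inj] reach_Suc(1)[of m \<sigma>] room_perm_code[OF inj] Suc.prems False by simp
  qed
qed simp

section \<open>Recovering a permutation from its code\<close>

lemma ascends_eq_if_perm_code_eq:
  assumes "perm_code \<sigma> n = perm_code \<tau> n" "inj_on \<sigma> {1..n}" "inj_on \<tau> {1..n}"
    and "ascends \<sigma> 1" "ascends \<tau> 1" "1 \<le> n"
  shows "ascends \<sigma> n \<longleftrightarrow> ascends \<tau> n"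
  using assms(6,1-5)
proof (induction n rule: nat_induct_at_least)
  case (Suc m)
  have inj: "inj_on \<sigma> {1..m}" "inj_on \<tau> {1..m}"
    using Suc.prems(2,3) by (auto elim!: inj_on_subset)
  then have "ascends \<sigma> m \<longleftrightarrow> ascends \<tau> m" using Suc.IH Suc.prems by simp
  moreover have "reach \<sigma> m = reach \<tau> m"
    using room_perm_code[OF inj(1) Suc.hyps] room_perm_code[OF inj(2) Suc.hyps] Suc.prems(1) by simp
  ultimately show ?case
    using reach_Suc(1)[OF Suc.hyps Suc.prems(2)] reach_Suc(1)[OF Suc.hyps Suc.prems(3)] Suc.prems(1)
    by auto
qed simp

text \<open>The direction and \<open>reach\<close> at the last position fix the rank of the last
  value in the common image, hence that value. Arbitrary equal images are allowed because deleting
  the last value need not leave a permutation of \<open>{1..m}\<close>.\<close>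

lemma perm_code_inject:
  assumes "perm_code \<sigma> n = perm_code \<tau> n" "inj_on \<sigma> {1..n}" "inj_on \<tau> {1..n}"
    and "ascends \<sigma> 1" "ascends \<tau> 1" and "\<sigma> ` {1..n} = \<tau> ` {1..n}" and "i \<in> {1..n}"
  shows "\<sigma> i = \<tau> i"
  using assms
proof (induction n arbitrary: i)
  case (Suc m)
  define A where "A = \<sigma> ` {1..Suc m}"
  have split: "{1..Suc m} = insert (Suc m) {1..<Suc m}" by auto
  have above: "card {i\<in>{1..<Suc m}. \<rho> (Suc m) < \<rho> i} = card {a\<in>A. \<rho> (Suc m) < a}"
    and below: "card {i\<in>{1..<Suc m}. \<rho> i < \<rho> (Suc m)} = card {a\<in>A. a < \<rho> (Suc m)}"
    if "inj_on \<rho> {1..Suc m}" "A = \<rho> ` {1..Suc m}" for \<rho> :: "nat \<Rightarrow> nat"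
    unfolding that(2) split using that(1)
    by (intro bij_betw_same_card[where f = \<rho>]; auto simp: bij_betw_def inj_on_def)+
  have mem: "\<sigma> (Suc m) \<in> A" "\<tau> (Suc m) \<in> A" "finite A"
    using Suc.prems by (auto simp: A_def)
  have A: "A = \<sigma> ` {1..Suc m}" "A = \<tau> ` {1..Suc m}"
    using Suc.prems(6) by (simp_all add: A_def)
  have asc: "ascends \<sigma> (Suc m) \<longleftrightarrow> ascends \<tau> (Suc m)"
    using ascends_eq_if_perm_code_eq[OF Suc.prems(1-5)] by simp
  have "reach \<sigma> (Suc m) = reach \<tau> (Suc m)"
    using room_perm_code[OF Suc.prems(2)] room_perm_code[OF Suc.prems(3)]
    by (simp add: Suc.prems(1) del: perm_code.simps)
  then have ranks: "(if ascends \<sigma> (Suc m) then card {a\<in>A. \<sigma> (Suc m) < a} else card {a\<in>A. a < \<sigma> (Suc m)}) =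
      (if ascends \<sigma> (Suc m) then card {a\<in>A. \<tau> (Suc m) < a} else card {a\<in>A. a < \<tau> (Suc m)})"
    unfolding above[OF Suc.prems(2) A(1), symmetric] above[OF Suc.prems(3) A(2), symmetric]
      below[OF Suc.prems(2) A(1), symmetric] below[OF Suc.prems(3) A(2), symmetric]
    using asc by (cases "ascends \<sigma> (Suc m)") (simp_all add: reach_def)
  have lt: "card {a\<in>A. y < a} < card {a\<in>A. x < a} \<and> card {a\<in>A. a < x} < card {a\<in>A. a < y}"
    if "x < y" "x \<in> A" "y \<in> A" for x y
    using that mem(3) by (auto intro!: psubset_card_mono)
  have last: "\<sigma> (Suc m) = \<tau> (Suc m)"
    using ranks lt[of "\<sigma> (Suc m)" "\<tau> (Suc m)"] lt[of "\<tau> (Suc m)" "\<sigma> (Suc m)"] mem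
    by (cases "\<sigma> (Suc m)" "\<tau> (Suc m)" rule: linorder_cases) (auto split: if_splits)
  show ?case
  proof (cases "i = Suc m")
    case False
    have "{1..m} = {1..Suc m} - {Suc m}" by auto
    then have im: "\<sigma> ` {1..m} = \<tau> ` {1..m}"
      using inj_on_image_set_diff[OF Suc.prems(2), of "{1..Suc m}" "{Suc m}"]
        inj_on_image_set_diff[OF Suc.prems(3), of "{1..Suc m}" "{Suc m}"] Suc.prems(6) last by simp
    show ?thesis
    proof (rule Suc.IH)
      show "inj_on \<sigma> {1..m}" "inj_on \<tau> {1..m}"
        using Suc.prems(2,3) by (auto elim!: inj_on_subset)
    qed (use Suc.prems im False in auto)
  qed (use last in simp)
qed simp

text \<open>Surjectivity follows by counting, as both sides have \<open>fact n\<close>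
  elements.\<close>

lemma bij_betw_perm_code: "bij_betw (\<lambda>\<sigma>. perm_code \<sigma> n) {\<sigma>. \<sigma> permutes {1..n}} (codes n)"
proof -
  have inj: "inj_on (\<lambda>\<sigma>. perm_code \<sigma> n) {\<sigma>. \<sigma> permutes {1..n}}"
  proof (rule inj_onI, clarify)
    fix \<sigma> \<tau> assume *: "\<sigma> permutes {1..n}" "\<tau> permutes {1..n}" "perm_code \<sigma> n = perm_code \<tau> n"
    \<comment> \<open>The value 0 at position 0 makes the first step an ascent, which fixes the
      initial direction for decoding.\<close>
    have asc: "ascends \<rho> 1" if "\<rho> permutes {1..n}" for \<rho>
    proof -
      have "\<rho> 0 = 0" using that by (auto intro: permutes_not_in)
      moreover have "\<rho> 1 \<noteq> \<rho> 0" using permutes_inj[OF that] by (auto dest: injD)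
      ultimately show ?thesis by (simp add: ascends_def)
    qed
    show "\<sigma> = \<tau>"
    proof
      fix i
      show "\<sigma> i = \<tau> i"
      proof (cases "i \<in> {1..n}")
        case True
        show ?thesis
          by (rule perm_code_inject[OF *(3) _ _ asc asc _ True])
             (use * in \<open>auto simp: permutes_image intro: permutes_inj_on\<close>)
      qed (use * in \<open>simp add: permutes_not_in\<close>)
    qed
  qed
  moreover have "(\<lambda>\<sigma>. perm_code \<sigma> n) ` {\<sigma>. \<sigma> permutes {1..n}} = codes n"
  proof (rule card_subset_eq)
    show "card ((\<lambda>\<sigma>. perm_code \<sigma> n) ` {\<sigma>. \<sigma> permutes {1..n}}) = card (codes n)"
      using card_permutations[of "{1..n}" n] by (subst card_image[OF inj]) (simp add: card_codes)
  qed (auto simp: finite_codes perm_code_in_codes)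
  ultimately show ?thesis by (simp add: bij_betw_def)
qed

section \<open>Code statistics as 3-inversions, double ascents and double descents\<close>

lemma permutes_consecutive:
  assumes "\<sigma> permutes A" and "j \<in> {2..n}"
  obtains m where "j = Suc (Suc m)" "\<sigma> m \<noteq> \<sigma> (Suc m)" "\<sigma> (Suc m) \<noteq> \<sigma> (Suc (Suc m))"
proof -
  obtain m where "j = Suc (Suc m)" using assms(2) by (metis add_2_eq_Suc atLeastAtMost_iff le_Suc_ex)
  then show ?thesis using that by (simp add: inj_eq[OF permutes_inj[OF assms(1)]])
qed

lemma three_inversions_eq:
  assumes "\<sigma> permutes {1..n}" "j \<le> n"
  shows "{i. three_inversion n \<sigma> i j} = {i\<in>{1..<j}.
     if ascends \<sigma> (j - 1)
     then if ascends \<sigma> j then \<sigma> (j - 1) < \<sigma> i \<and> \<sigma> i < \<sigma> j else \<sigma> j < \<sigma> i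
     else if ascends \<sigma> j then \<sigma> i < \<sigma> j else \<sigma> j < \<sigma> i \<and> \<sigma> i < \<sigma> (j - 1)}"
proof (cases "j \<in> {2..n}")
  case True
  with assms(1) obtain m where
    m: "j = Suc (Suc m)" "\<sigma> m \<noteq> \<sigma> (Suc m)" "\<sigma> (Suc m) \<noteq> \<sigma> (Suc (Suc m))"
    by (rule permutes_consecutive)
  show ?thesis
    using assms(2) m(2,3)
    by (intro Collect_cong, cases "\<sigma> m" "\<sigma> (Suc m)" rule: linorder_cases;
        cases "\<sigma> (Suc m)" "\<sigma> (Suc (Suc m))" rule: linorder_cases)
       (simp_all add: m(1) three_inversion_def double_ascent_def double_descent_def peak_def valley_def
          ascends_def conj_ac)
next
  case False
  then have "j \<le> 1" using assms(2) by simp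
  then show ?thesis by (auto simp: three_inversion_def)
qed

lemma sum_list_perm_code:
  assumes "\<sigma> permutes {1..n}"
  shows "sum_list (perm_code \<sigma> n) = inv3 n \<sigma>"
proof -
  have "sum_list (perm_code \<sigma> m) = (\<Sum>j=1..m. inv_at \<sigma> j)" for m
    by (induction m) simp_all
  moreover have "inv3 n \<sigma> = card (SIGMA j:{1..n}. {i. three_inversion n \<sigma> i j})"
    unfolding inv3_def
    by (rule bij_betw_same_card[where f = "\<lambda>(i, j). (j, i)"])
       (auto simp: bij_betw_def inj_on_def three_inversion_def image_iff)
  moreover have "\<dots> = (\<Sum>j=1..n. inv_at \<sigma> j)"
  proof (subst card_SigmaI)
    show "\<forall>j\<in>{1..n}. finite {i. three_inversion n \<sigma> i j}"
      by (auto simp: three_inversions_eq[OF assms])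
    show "(\<Sum>j=1..n. card {i. three_inversion n \<sigma> i j}) = (\<Sum>j=1..n. inv_at \<sigma> j)"
      by (rule sum.cong) (simp_all only: three_inversions_eq[OF assms] inv_at_def atLeastAtMost_iff)
  qed simp
  ultimately show ?thesis by simp
qed

lemma monot_eq_mono_steps:
  assumes "\<sigma> permutes {1..n}"
  shows "monot n \<sigma> = mono_steps (perm_code \<sigma> n)"
proof -
  have "double_ascent n \<sigma> j \<or> double_descent n \<sigma> j \<longleftrightarrow> (ascends \<sigma> j \<longleftrightarrow> ascends \<sigma> (j - 1))"
    if "j \<in> {2..n}" for j
  proof -
    from assms that obtain m where
      m: "j = Suc (Suc m)" "\<sigma> m \<noteq> \<sigma> (Suc m)" "\<sigma> (Suc m) \<noteq> \<sigma> (Suc (Suc m))"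
      by (rule permutes_consecutive)
    show ?thesis
      using that m(2,3)
      by (cases "\<sigma> m" "\<sigma> (Suc m)" rule: linorder_cases;
          cases "\<sigma> (Suc m)" "\<sigma> (Suc (Suc m))" rule: linorder_cases)
         (simp_all add: m(1) double_ascent_def double_descent_def ascends_def)
  qed
  then have "{j\<in>{2..n}. double_ascent n \<sigma> j \<or> double_descent n \<sigma> j} =
      {j\<in>{2..n}. ascends \<sigma> j \<longleftrightarrow> ascends \<sigma> (j - 1)}"
    by blast
  then show ?thesis
    by (simp only: monot_def mono_steps_perm_code[OF permutes_inj_on[OF assms]])
qed

lemma sum_permutations_eq_sum_codes:
  fixes f :: "nat \<Rightarrow> nat \<Rightarrow> 'a::comm_monoid_add"
  shows "(\<Sum>\<sigma> | \<sigma> permutes {1..n}. f (inv3 n \<sigma>) (monot n \<sigma>)) =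
    (\<Sum>es\<in>codes n. f (sum_list es) (mono_steps es))"
  by (subst sum.reindex_bij_betw[OF bij_betw_perm_code, symmetric])
     (simp add: sum_list_perm_code monot_eq_mono_steps)

section \<open>Dyck paths and their columns\<close>

text \<open>A recursive form of \<open>column\<close>, with the current abscissa as accumulator,
  suited to induction over the path.\<close>

fun cols :: "nat \<Rightarrow> step list \<Rightarrow> nat list" where
  "cols c [] = []"
| "cols c (North # p) = c # cols c p"
| "cols c (East # p) = cols (Suc c) p"

lemma length_cols [simp]: "length (cols c p) = count_list p North"
  by (induction c p rule: cols.induct) auto

lemma cols_eq_map:
  "cols c p = map (\<lambda>m. c + count_list (take m p) East) (filter (\<lambda>m. p ! m = North) [0..<length p])"
proof (induction c p rule: cols.induct)
  case (2 c p)
  have "[0..<length (North # p)] = 0 # map Suc [0..<length p]"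
    by (simp add: upt_conv_Cons map_Suc_upt del: upt_Suc)
  then show ?case using 2 by (simp add: filter_map comp_def)
next
  case (3 c p)
  have "[0..<length (East # p)] = 0 # map Suc [0..<length p]"
    by (simp add: upt_conv_Cons map_Suc_upt del: upt_Suc)
  then show ?case using 3 by (simp add: filter_map comp_def)
qed simp

lemma column_eq_cols:
  assumes "i \<in> {1..count_list p North}"
  shows "column p i = cols 0 p ! (i - 1)"
proof -
  have "length (filter (\<lambda>m. p ! m = North) [0..<length p]) = count_list p North"
    using length_cols[of 0 p] unfolding cols_eq_map by simp
  then show ?thesis
    using assms by (cases i) (auto simp: cols_eq_map column_def north_pos_def)
qed

lemma cols_bounds: "d \<in> set (cols c p) \<Longrightarrow> c \<le> d \<and> d \<le> c + count_list p East"
  by (induction c p rule: cols.induct) auto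

lemma sorted_cols: "sorted (cols c p)"
  by (induction c p rule: cols.induct) (auto dest: cols_bounds)

text \<open>Between north steps the path only moves east, so after the start the condition is
  tightest just before a north step and at the end.\<close>

lemma ballot_iff_cols:
  "(\<forall>m\<le>length p. c + count_list (take m p) East \<le> h + count_list (take m p) North) \<longleftrightarrow>
    c \<le> h \<and> (\<forall>i<length (cols c p). cols c p ! i \<le> h + i) \<and> c + count_list p East \<le> h + count_list p North"
proof (induction c p arbitrary: h rule: cols.induct)
  case (1 c)
  then show ?case by simp
next
  case (2 c p)
  have "(\<forall>m\<le>length (North # p). c + count_list (take m (North # p)) East \<le> h + count_list (take m (North # p)) North)
      \<longleftrightarrow> c \<le> h \<and> (\<forall>m\<le>length p. c + count_list (take m p) East \<le> Suc h + count_list (take m p) North)"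
    by (simp only: list.size add_0_right add_Suc_right All_less_Suc2[symmetric] less_Suc_eq_le[symmetric])
       (simp add: All_less_Suc2 del: length_cols)
  also have "\<dots> \<longleftrightarrow> c \<le> h \<and> (\<forall>i<length (cols c p). cols c p ! i \<le> Suc h + i) \<and> c + count_list p East \<le> Suc h + count_list p North"
    using 2[of "Suc h"] by auto
  finally show ?case by (simp add: All_less_Suc2 del: length_cols)
next
  case (3 c p)
  have "(\<forall>m\<le>length (East # p). c + count_list (take m (East # p)) East \<le> h + count_list (take m (East # p)) North)
      \<longleftrightarrow> c \<le> h \<and> (\<forall>m\<le>length p. Suc c + count_list (take m p) East \<le> h + count_list (take m p) North)"
    by (simp only: list.size add_0_right add_Suc_right less_Suc_eq_le[symmetric])
       (simp add: All_less_Suc2)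
  also have "\<dots> \<longleftrightarrow> c \<le> h \<and> Suc c \<le> h \<and> (\<forall>i<length (cols (Suc c) p). cols (Suc c) p ! i \<le> h + i) \<and> Suc c + count_list p East \<le> h + count_list p North"
    using 3[of h] by auto
  also have "\<dots> \<longleftrightarrow> c \<le> h \<and> (\<forall>i<length (cols (Suc c) p). cols (Suc c) p ! i \<le> h + i) \<and> Suc c + count_list p East \<le> h + count_list p North"
  proof -
    \<comment> \<open>The bound after the east step follows from the test at the next north step or,
      if there is none, at the end.\<close>
    have "Suc c \<le> h" if "\<forall>i<length (cols (Suc c) p). cols (Suc c) p ! i \<le> h + i" "Suc c + count_list p East \<le> h + count_list p North"
    proof (cases "cols (Suc c) p")
      case Nil
      then have "count_list p North = 0" by (metis length_cols list.size(3))
      then show ?thesis using that(2) by simp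
    next
      case (Cons d ds)
      then have "Suc c \<le> d" using cols_bounds[of d "Suc c" p] by simp
      then show ?thesis using that(1)[rule_format, of 0] Cons by (simp del: length_cols)
    qed
    then show ?thesis by blast
  qed
  finally show ?case by simp
qed

lemma dyck_path_iff_cols:
  "dyck_path n p \<longleftrightarrow> count_list p North = n \<and> count_list p East = n \<and> (\<forall>i<n. cols 0 p ! i \<le> i)"
  using ballot_iff_cols[of p 0 0] by (auto simp: dyck_path_def)

text \<open>On a Dyck path the subtraction in \<open>area_word_eq\<close> is not truncated.\<close>

lemma dyck_column_area:
  assumes "dyck_path n p" "i \<in> {1..n}"
  shows "column p i + area_word p i = i - 1"
proof -
  have "column p i \<le> i - 1"
    using assms by (auto simp: dyck_path_iff_cols column_eq_cols)
  then show ?thesis by (simp add: area_word_eq)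
qed

lemma dyck_column_mono:
  assumes "dyck_path n p" "1 \<le> i" "i \<le> j" "j \<le> n"
  shows "column p i \<le> column p j"
  using assms sorted_nth_mono[OF sorted_cols, of "i - 1" "j - 1" 0 p]
  by (simp add: dyck_path_iff_cols column_eq_cols)

text \<open>If the first steps differ, \<open>c\<close> is a column of the path that starts north
  but not of the one that starts east. The count of east steps fixes the final run.\<close>

lemma cols_inject: "cols c p = cols c q \<Longrightarrow> count_list p East = count_list q East \<Longrightarrow> p = q"
proof (induction c p arbitrary: q rule: cols.induct)
  case (1 c)
  have "count_list q North = 0" using 1(1) by (metis cols.simps(1) length_cols list.size(3))
  moreover have "count_list q East = 0" using 1(2) by simp
  ultimately show ?case by (cases q; cases "hd q") auto
next
  case (2 c p)
  show ?case
  proof (cases q)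
    case (Cons s q')
    show ?thesis
    proof (cases s)
      case East
      then have "c \<in> set (cols (Suc c) q')" using 2 Cons by (metis cols.simps(2,3) list.set_intros(1))
      then show ?thesis using cols_bounds by fastforce
    qed (use 2 Cons in auto)
  qed (use 2 in auto)
next
  case (3 c p)
  show ?case
  proof (cases q)
    case (Cons s q')
    show ?thesis
    proof (cases s)
      case North
      then have "c \<in> set (cols (Suc c) p)" using 3 Cons by (metis cols.simps(2,3) list.set_intros(1))
      then show ?thesis using cols_bounds by fastforce
    qed (use 3 Cons in auto)
  qed (use 3 in auto)
qed

lemma cols_replicate_East: "cols c (replicate k East @ p) = cols (c + k) p"
  by (induction k arbitrary: c) auto

lemma cols_surj:
  assumes "sorted ds" "\<And>d. d \<in> set ds \<Longrightarrow> c \<le> d \<and> d \<le> c + e"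
  shows "\<exists>p. cols c p = ds \<and> count_list p East = e \<and> count_list p North = length ds"
  using assms
proof (induction ds arbitrary: c e)
  case Nil
  have "count_list (replicate e East) East = e" "count_list (replicate e East) North = 0"
    by (induction e) auto
  then show ?case using cols_replicate_East[of c e "[]"] by (intro exI[of _ "replicate e East"]) simp
next
  case (Cons d ds)
  have d: "c \<le> d" "d \<le> c + e" using Cons.prems(2)[of d] by auto
  have "\<exists>p. cols d p = ds \<and> count_list p East = c + e - d \<and> count_list p North = length ds"
  proof (rule Cons.IH)
    show "sorted ds" using Cons.prems(1) by simp
    show "d \<le> d' \<and> d' \<le> d + (c + e - d)" if "d' \<in> set ds" for d'
      using Cons.prems that d by fastforce
  qed
  then obtain p where p: "cols d p = ds" "count_list p East = c + e - d" "count_list p North = length ds"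
    by blast
  have "count_list (replicate k East @ q) East = k + count_list q East"
    "count_list (replicate k East @ q) North = count_list q North" for k q
    by (induction k) auto
  then show ?case
    using p d by (intro exI[of _ "replicate (d - c) East @ North # p"]) (simp add: cols_replicate_East)
qed

lemma dyck_path_eqI:
  assumes "dyck_path n p" "dyck_path n q" "\<And>i. i \<in> {1..n} \<Longrightarrow> column p i = column q i"
  shows "p = q"
proof (rule cols_inject)
  show "cols 0 p = cols 0 q"
  proof (rule nth_equalityI)
    show "length (cols 0 p) = length (cols 0 q)"
      using assms by (simp add: dyck_path_def)
    show "cols 0 p ! i = cols 0 q ! i" if "i < length (cols 0 p)" for i
      using assms(1,2) assms(3)[of "Suc i"] that by (auto simp: dyck_path_def column_eq_cols)
  qed
qed (use assms in \<open>simp add: dyck_path_def\<close>)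

lemma dyck_path_with_columns:
  assumes "\<And>i. i \<in> {1..n} \<Longrightarrow> c i \<le> i - 1" and "\<And>i. 1 \<le> i \<Longrightarrow> i < n \<Longrightarrow> c i \<le> c (Suc i)"
  shows "\<exists>p. dyck_path n p \<and> (\<forall>i\<in>{1..n}. column p i = c i)"
proof -
  let ?ds = "map c [1..<Suc n]"
  have "sorted ?ds"
    using assms(2) by (auto simp: sorted_iff_nth_Suc simp del: upt_Suc)
  moreover have "0 \<le> d \<and> d \<le> 0 + n" if "d \<in> set ?ds" for d
    using that assms(1) by fastforce
  ultimately obtain p where p: "cols 0 p = ?ds" "count_list p East = n" "count_list p North = length ?ds"
    using cols_surj by blast
  have "dyck_path n p"
    using p assms(1)[of "Suc i" for i] by (auto simp: dyck_path_iff_cols simp del: upt_Suc)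
  moreover have "column p i = c i" if "i \<in> {1..n}" for i
    using that p by (cases i) (auto simp: column_eq_cols simp del: upt_Suc)
  ultimately show ?thesis by blast
qed

text \<open>Columns weakly increase, so all steps between two steps of one column lie in it, and
  comparing neighbours suffices.\<close>

lemma standard_labelling_iff:
  assumes "dyck_path n p"
  shows "standard_labelling n p w \<longleftrightarrow> w permutes {1..n} \<and>
    (\<forall>i. 1 \<le> i \<and> i < n \<and> column p i = column p (Suc i) \<longrightarrow> w i < w (Suc i))"
proof -
  have "w i < w j" if asc: "\<And>i. 1 \<le> i \<Longrightarrow> i < n \<Longrightarrow> column p i = column p (Suc i) \<Longrightarrow> w i < w (Suc i)"
    and ij: "Suc i \<le> j" "1 \<le> i" "j \<le> n" "column p i = column p j" for i j
    using ij
  proof (induction j rule: dec_induct)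
    case base
    then show ?case using asc by simp
  next
    case (step j)
    have "column p j = column p i" "column p j = column p (Suc j)"
      using dyck_column_mono[OF assms, of i j] dyck_column_mono[OF assms, of j "Suc j"] step by auto
    then show ?case using step.IH step.prems step.hyps asc[of j] by simp
  qed
  then show ?thesis by (auto simp: standard_labelling_def)
qed

section \<open>The word of a decorated path\<close>

lemma key_less:
  fixes a a' w w' N :: int
  assumes "0 < w" "w < N" "0 < w'" "w' < N"
  shows "N * a' - w' < N * a - w \<longleftrightarrow> a' < a \<or> a' = a \<and> w < w'"
proof (cases a' a rule: linorder_cases)
  case less
  then have "N * (a' + 1) \<le> N * a" using assms by (intro mult_left_mono) auto
  then show ?thesis using less assms by (simp add: algebra_simps)
next
  case greater
  then have "N * (a + 1) \<le> N * a'" using assms by (intro mult_left_mono) auto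
  then show ?thesis using greater assms by (simp add: algebra_simps)
qed simp

locale path_words = modulus N for N :: int +
  fixes n :: nat
  assumes N_eq: "N = int n + 1"
begin

definition key :: "step list \<Rightarrow> (nat \<Rightarrow> nat) \<Rightarrow> nat \<Rightarrow> int" where
  "key p w i = N * int (area_word p i) - int (w i)"

definition paths :: "decorated_path set" where
  "paths = {(p, w, dv). dyck_path n p \<and> standard_labelling n p w \<and> dv \<subseteq> contractible_valleys n p w}"

text \<open>Decorations are recorded as values instead of positions; nothing is lost because the
  keys are distinct.\<close>

definition word :: "decorated_path \<Rightarrow> int list \<times> int set" where
  "word = (\<lambda>(p, w, dv). (map (key p w) [1..<Suc n], key p w ` dv))"

definition words :: "(int list \<times> int set) set" where
  "words = {(l, D). distinct l \<and> D \<subseteq> set l \<and> inj_on (\<lambda>x. x mod N) (set l) \<and>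
     (\<lambda>x. x mod N) ` set l = {1..int n} \<and> (\<forall>x\<in>set l. - N < x) \<and> admissible (- N) D l}"

section \<open>Keys of a single labelled path\<close>

context
  fixes p :: "step list" and w :: "nat \<Rightarrow> nat"
  assumes dyck: "dyck_path n p" and perm: "w permutes {1..n}"
begin

lemma label_bounds: "i \<in> {1..n} \<Longrightarrow> 0 < int (w i) \<and> int (w i) < N"
  using permutes_in_image[OF perm, of i] by (simp add: N_eq)

lemma key_less_iff:
  assumes "i \<in> {1..n}" "j \<in> {1..n}"
  shows "key p w i < key p w j \<longleftrightarrow>
    area_word p i < area_word p j \<or> area_word p i = area_word p j \<and> w j < w i"
  using key_less[of "int (w j)" N "int (w i)" "int (area_word p i)" "int (area_word p j)"]
    label_bounds assms by (simp add: key_def)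

lemma key_less_add_iff:
  assumes "i \<in> {1..n}" "j \<in> {1..n}"
  shows "key p w i < key p w j + N \<longleftrightarrow>
    area_word p i < Suc (area_word p j) \<or> area_word p i = Suc (area_word p j) \<and> w j < w i"
  using key_less[of "int (w j)" N "int (w i)" "int (area_word p i)" "int (area_word p j) + 1"]
    label_bounds assms by (simp add: key_def algebra_simps) linarith

lemma key_mod:
  assumes "i \<in> {1..n}"
  shows "key p w i mod N = N - int (w i)"
  by (rule int_mod_pos_eq[where q = "int (area_word p i) - 1"])
     (use label_bounds[OF assms] in \<open>auto simp: key_def algebra_simps\<close>)

lemma inj_on_key_mod: "inj_on (\<lambda>i. key p w i mod N) {1..n}"
proof (rule inj_onI)
  fix i j assume "i \<in> {1..n}" "j \<in> {1..n}" "key p w i mod N = key p w j mod N"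
  then have "w i = w j" by (simp add: key_mod)
  then show "i = j" using permutes_inj[OF perm] by (simp add: inj_eq)
qed

lemma inj_on_key: "inj_on (key p w) {1..n}"
  using inj_on_imageI2[of "\<lambda>x. x mod N" "key p w"] inj_on_key_mod by (simp add: comp_def)

lemma key_mod_image: "(\<lambda>i. key p w i mod N) ` {1..n} = {1..int n}"
proof -
  have "(\<lambda>i. key p w i mod N) ` {1..n} = (\<lambda>i. N - int i) ` w ` {1..n}"
    unfolding image_image by (rule image_cong) (simp_all only: key_mod)
  also have "\<dots> = (\<lambda>i. N - int i) ` {1..n}"
    by (simp only: permutes_image[OF perm])
  also have "\<dots> = {1..int n}"
  proof (intro equalityI subsetI)
    fix x assume "x \<in> {1..int n}"
    then show "x \<in> (\<lambda>i. N - int i) ` {1..n}"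
      by (intro image_eqI[of _ _ "nat (N - x)"]) (auto simp: N_eq)
  qed (auto simp: N_eq)
  finally show ?thesis .
qed

lemma key_gt:
  assumes "i \<in> {1..n}"
  shows "- N < key p w i"
proof -
  have "0 \<le> N * int (area_word p i)" using N_pos by simp
  then show ?thesis using label_bounds[OF assms] unfolding key_def by linarith
qed

lemma set_word: "set (map (key p w) [1..<Suc n]) = key p w ` {1..n}"
  by (simp add: atLeastLessThanSuc_atLeastAtMost del: upt_Suc)

lemma distinct_word: "distinct (map (key p w) [1..<Suc n])"
  using inj_on_key by (simp add: distinct_map atLeastLessThanSuc_atLeastAtMost del: upt_Suc)

lemma key_in_image_iff: "i \<in> {1..n} \<Longrightarrow> dv \<subseteq> {1..n} \<Longrightarrow> key p w i \<in> key p w ` dv \<longleftrightarrow> i \<in> dv"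
  using inj_on_key by (auto dest: inj_onD)

lemma area_word_Suc:
  assumes "1 \<le> i" "i < n"
  shows "area_word p (Suc i) \<le> Suc (area_word p i)"
    and "area_word p (Suc i) = Suc (area_word p i) \<longleftrightarrow> column p i = column p (Suc i)"
  using dyck_column_area[OF dyck, of i] dyck_column_area[OF dyck, of "Suc i"]
    dyck_column_mono[OF dyck, of i "Suc i"] assms by auto

text \<open>The area word rises by at most one per step, and by one exactly within a column. Rising
  by less than \<open>N\<close> therefore says that labels increase within columns, and a descent to
  a decorated value says that its valley is contractible. The first key is negative anyway, so the
  head condition only forbids decorating index 1.\<close>

lemma admissible_word_iff:
  assumes dv: "dv \<subseteq> {1..n}"
  shows "admissible (- N) (key p w ` dv) (map (key p w) [1..<Suc n]) \<longleftrightarrow>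
    standard_labelling n p w \<and> dv \<subseteq> contractible_valleys n p w"
proof -
  let ?K = "key p w"
  have "admissible (- N) (?K ` dv) (map ?K [1..<Suc n]) \<longleftrightarrow>
      (\<forall>i. Suc i < n \<longrightarrow> ?K (Suc (Suc i)) < ?K (Suc i) + N \<and>
        (?K (Suc (Suc i)) \<in> ?K ` dv \<longrightarrow> ?K (Suc (Suc i)) < ?K (Suc i))) \<and>
      (n \<noteq> 0 \<longrightarrow> ?K 1 \<notin> ?K ` dv \<and> ?K 1 < 0)"
    by (simp add: admissible_def successively_conv_nth hd_map hd_upt del: upt_Suc)
  also have "\<dots> \<longleftrightarrow>
      (\<forall>i. Suc i < n \<longrightarrow> (column p (Suc i) = column p (Suc (Suc i)) \<longrightarrow> w (Suc i) < w (Suc (Suc i))) \<and>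
        (Suc (Suc i) \<in> dv \<longrightarrow> Suc (Suc i) \<in> contractible_valleys n p w)) \<and>
      (n \<noteq> 0 \<longrightarrow> 1 \<notin> dv)"
  proof -
    have "?K (Suc (Suc i)) < ?K (Suc i) + N \<longleftrightarrow>
        (column p (Suc i) = column p (Suc (Suc i)) \<longrightarrow> w (Suc i) < w (Suc (Suc i)))"
      and "(?K (Suc (Suc i)) \<in> ?K ` dv \<longrightarrow> ?K (Suc (Suc i)) < ?K (Suc i)) \<longleftrightarrow>
        (Suc (Suc i) \<in> dv \<longrightarrow> Suc (Suc i) \<in> contractible_valleys n p w)" if i: "Suc i < n" for i
    proof -
      have mem: "Suc i \<in> {1..n}" "Suc (Suc i) \<in> {1..n}" using i by auto
      show "?K (Suc (Suc i)) < ?K (Suc i) + N \<longleftrightarrow>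
          (column p (Suc i) = column p (Suc (Suc i)) \<longrightarrow> w (Suc i) < w (Suc (Suc i)))"
        using key_less_add_iff[OF mem(2,1)] area_word_Suc[of "Suc i"] i by auto
      show "(?K (Suc (Suc i)) \<in> ?K ` dv \<longrightarrow> ?K (Suc (Suc i)) < ?K (Suc i)) \<longleftrightarrow>
          (Suc (Suc i) \<in> dv \<longrightarrow> Suc (Suc i) \<in> contractible_valleys n p w)"
        using key_less_iff[OF mem(2,1)] key_in_image_iff[OF mem(2) dv] mem
        by (auto simp: contractible_valleys_def)
    qed
    moreover have "?K 1 \<notin> ?K ` dv \<and> ?K 1 < 0 \<longleftrightarrow> 1 \<notin> dv" if "n \<noteq> 0"
    proof -
      have mem: "1 \<in> {1..n}" using that by auto
      then have "area_word p 1 = 0" using dyck_column_area[OF dyck, of 1] by simp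
      then have "?K 1 < 0" using label_bounds[OF mem] by (simp add: key_def)
      then show ?thesis using key_in_image_iff[OF mem dv] by simp
    qed
    ultimately show ?thesis by blast
  qed
  also have "\<dots> \<longleftrightarrow> standard_labelling n p w \<and> dv \<subseteq> contractible_valleys n p w"
  proof -
    have shift: "(\<forall>i. 1 \<le> i \<and> i < n \<and> Q i \<longrightarrow> R i) \<longleftrightarrow> (\<forall>i. Suc i < n \<longrightarrow> Q (Suc i) \<longrightarrow> R (Suc i))"
      for Q R :: "nat \<Rightarrow> bool"
      by (metis One_nat_def Suc_le_D le_add1 plus_1_eq_Suc)
    have "standard_labelling n p w \<longleftrightarrow>
        (\<forall>i. Suc i < n \<longrightarrow> column p (Suc i) = column p (Suc (Suc i)) \<longrightarrow> w (Suc i) < w (Suc (Suc i)))"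
      by (simp only: standard_labelling_iff[OF dyck] shift perm simp_thms)
    moreover have "dv \<subseteq> contractible_valleys n p w \<longleftrightarrow>
        (\<forall>i. Suc i < n \<longrightarrow> Suc (Suc i) \<in> dv \<longrightarrow> Suc (Suc i) \<in> contractible_valleys n p w) \<and> (n \<noteq> 0 \<longrightarrow> 1 \<notin> dv)"
    proof (intro iffI conjI allI impI subsetI)
      fix i assume r: "(\<forall>i. Suc i < n \<longrightarrow> Suc (Suc i) \<in> dv \<longrightarrow> Suc (Suc i) \<in> contractible_valleys n p w) \<and> (n \<noteq> 0 \<longrightarrow> 1 \<notin> dv)"
        and i: "i \<in> dv"
      have "1 \<le> i" "i \<le> n" using i dv by auto
      moreover from this have "i \<noteq> 1" using r i by auto
      ultimately have "2 \<le> i" by simp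
      then obtain k where "i = Suc (Suc k)" using le_Suc_ex[of 2 i] by auto
      then show "i \<in> contractible_valleys n p w" using r i \<open>i \<le> n\<close> by simp
    qed (auto simp: contractible_valleys_def)
    ultimately show ?thesis by blast
  qed
  finally show ?thesis .
qed

lemma attacks_word:
  assumes dv: "dv \<subseteq> {1..n}"
  shows "attacks (key p w ` {1..n} - key p w ` dv) (map (key p w) [1..<Suc n]) =
    card (primary_dinv n (p, w, dv)) + card (secondary_dinv n (p, w, dv))"
proof -
  let ?K = "key p w"
  let ?J = "\<lambda>i. {j\<in>{i<..n}. ?K i - N < ?K j \<and> ?K j < ?K i}"
  \<comment> \<open>\<open>attacks\<close> recurses through the suffixes of the word, so the formula
    is proved for the suffix from every \<open>k\<close>.\<close>
  have tail: "attacks U (map ?K [k..<Suc n]) = (\<Sum>i=k..n. of_bool (?K i \<in> U) * card (?J i))"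
    if "k \<le> Suc n" for U k
    using that
  proof (induction k rule: inc_induct)
    case (step k)
    have "length (filter (\<lambda>y. ?K k - N < y \<and> y < ?K k) (map ?K [Suc k..<Suc n])) =
        length (filter (\<lambda>j. ?K k - N < ?K j \<and> ?K j < ?K k) [Suc k..<Suc n])"
      by (simp add: filter_map comp_def del: upt_Suc)
    also have "\<dots> = card (?J k)"
      by (subst distinct_length_filter) (auto intro!: arg_cong[where f = card] simp del: upt_Suc)
    finally have "attacks U (map ?K [k..<Suc n]) =
        of_bool (?K k \<in> U) * card (?J k) + attacks U (map ?K [Suc k..<Suc n])"
      using step.hyps by (simp add: upt_conv_Cons del: upt_Suc)
    then show ?case
      using step.hyps by (simp only: step.IH sum.atLeast_Suc_atMost less_Suc_eq_le)
  qed simp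
  have "attacks (?K ` {1..n} - ?K ` dv) (map ?K [1..<Suc n]) =
      (\<Sum>i=1..n. of_bool (?K i \<in> ?K ` {1..n} - ?K ` dv) * card (?J i))"
    by (rule tail) simp
  also have "\<dots> = (\<Sum>i=1..n. of_bool (i \<notin> dv) * card (?J i))"
  proof (rule sum.cong[OF refl])
    fix i assume "i \<in> {1..n}"
    then have "?K i \<in> ?K ` {1..n} - ?K ` dv \<longleftrightarrow> i \<notin> dv"
      using key_in_image_iff[OF _ dv] by blast
    then show "of_bool (?K i \<in> ?K ` {1..n} - ?K ` dv) * card (?J i) = of_bool (i \<notin> dv) * card (?J i)"
      by (simp only:)
  qed
  also have "\<dots> = (\<Sum>i\<in>{1..n} - dv. card (?J i))"
    by (rule sum.mono_neutral_cong_right) auto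
  also have "\<dots> = card (SIGMA i:{1..n} - dv. ?J i)"
    by (subst card_SigmaI) auto
  also have "(SIGMA i:{1..n} - dv. ?J i) = primary_dinv n (p, w, dv) \<union> secondary_dinv n (p, w, dv)"
  proof -
    have iff: "?K i - N < ?K j \<and> ?K j < ?K i \<longleftrightarrow> area_word p i = area_word p j \<and> w i < w j \<or>
        area_word p i = area_word p j + 1 \<and> w j < w i" if "i \<in> {1..n}" "j \<in> {1..n}" for i j
    proof -
      have "?K i - N < ?K j \<longleftrightarrow> ?K i < ?K j + N" by linarith
      then show ?thesis
        unfolding key_less_add_iff[OF that] key_less_iff[OF that(2,1)] by auto
    qed
    have "(i, j) \<in> (SIGMA i:{1..n} - dv. ?J i) \<longleftrightarrow> (i, j) \<in> primary_dinv n (p, w, dv) \<union> secondary_dinv n (p, w, dv)"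
      for i j
    proof (cases "i \<in> {1..n} \<and> j \<in> {1..n}")
      case True
      then have "i \<in> {1..n}" "j \<in> {1..n}" by blast+
      from iff[OF this] this show ?thesis
        unfolding primary_dinv_def secondary_dinv_def mem_Sigma_iff Un_iff mem_Collect_eq prod.case
          Diff_iff greaterThanAtMost_iff atLeastAtMost_iff
        by blast
    next
      case False
      then show ?thesis by (auto simp: primary_dinv_def secondary_dinv_def)
    qed
    then show ?thesis by (intro set_eqI) (simp only: split_paired_all)
  qed
  also have "card \<dots> = card (primary_dinv n (p, w, dv)) + card (secondary_dinv n (p, w, dv))"
  proof (rule card_Un_disjoint)
    have "primary_dinv n (p, w, dv) \<subseteq> {1..n} \<times> {1..n}" "secondary_dinv n (p, w, dv) \<subseteq> {1..n} \<times> {1..n}"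
      by (auto simp: primary_dinv_def secondary_dinv_def)
    then show "finite (primary_dinv n (p, w, dv))" "finite (secondary_dinv n (p, w, dv))"
      by (auto intro: finite_subset)
  qed (auto simp: primary_dinv_def secondary_dinv_def)
  finally show ?thesis .
qed

lemma spread_word: "spread (- N) (key p w ` {1..n}) = (\<Sum>i=1..n. area_word p i)"
proof -
  have "(key p w i + N) div N = int (area_word p i)" if "i \<in> {1..n}" for i
    by (rule int_div_pos_eq[where r = "N - int (w i)"])
       (use label_bounds[OF that] in \<open>auto simp: key_def\<close>)
  then show ?thesis
    unfolding spread_def by (subst sum.reindex[OF inj_on_key]) simp
qed

end

section \<open>The bijection between decorated paths and words\<close>

lemma paths_D:
  assumes "(p, w, dv) \<in> paths"
  shows "dyck_path n p" "w permutes {1..n}" "dv \<subseteq> {1..n}"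
  using assms by (auto simp: paths_def standard_labelling_def contractible_valleys_def)

lemma word_in_words:
  assumes "P \<in> paths"
  shows "word P \<in> words"
proof -
  obtain p w dv where P: "P = (p, w, dv)" by (cases P) auto
  have dyck: "dyck_path n p" and lab: "standard_labelling n p w" and dv: "dv \<subseteq> contractible_valleys n p w"
    using assms by (auto simp: P paths_def)
  have perm: "w permutes {1..n}" using lab by (simp add: standard_labelling_def)
  have dv': "dv \<subseteq> {1..n}" using dv by (auto simp: contractible_valleys_def)
  show ?thesis
    unfolding P word_def words_def prod.case mem_Collect_eq set_word[OF dyck perm]
  proof (intro conjI ballI)
    show "distinct (map (key p w) [1..<Suc n])" by (rule distinct_word[OF dyck perm])
    show "key p w ` dv \<subseteq> key p w ` {1..n}" using dv' by blast
    show "inj_on (\<lambda>x. x mod N) (key p w ` {1..n})"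
      using inj_on_key_mod[OF dyck perm] by (rule inj_on_imageI[unfolded comp_def])
    show "(\<lambda>x. x mod N) ` key p w ` {1..n} = {1..int n}"
      unfolding image_image by (rule key_mod_image[OF dyck perm])
    show "- N < x" if "x \<in> key p w ` {1..n}" for x
      using that key_gt[OF dyck perm] by blast
    show "admissible (- N) (key p w ` dv) (map (key p w) [1..<Suc n])"
      using admissible_word_iff[OF dyck perm dv'] lab dv by blast
  qed
qed

lemma inj_on_word: "inj_on word paths"
proof (rule inj_onI)
  fix P Q assume mem: "P \<in> paths" "Q \<in> paths" and eq: "word P = word Q"
  obtain p w dv q v dw where PQ: "P = (p, w, dv)" "Q = (q, v, dw)"
    using prod_cases3 by metis
  note dyck = paths_D(1)[OF mem(1)[unfolded PQ]] paths_D(1)[OF mem(2)[unfolded PQ]]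
    and perm = paths_D(2)[OF mem(1)[unfolded PQ]] paths_D(2)[OF mem(2)[unfolded PQ]]
    and dv = paths_D(3)[OF mem(1)[unfolded PQ]] paths_D(3)[OF mem(2)[unfolded PQ]]
  have "map (key p w) [1..<Suc n] = map (key q v) [1..<Suc n]"
    using eq by (simp add: PQ word_def)
  then have key: "key p w i = key q v i" if "i \<in> {1..n}" for i
    using that unfolding map_eq_conv by (auto simp del: upt_Suc)
  have w: "w i = v i" if "i \<in> {1..n}" for i
    using key_mod[OF dyck(1) perm(1) that] key_mod[OF dyck(2) perm(2) that] key[OF that] by simp
  have "w = v"
  proof
    show "w i = v i" for i
      by (cases "i \<in> {1..n}") (use w perm in \<open>auto simp: permutes_not_in\<close>)
  qed
  moreover have "p = q"
  proof (rule dyck_path_eqI[OF dyck])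
    fix i assume i: "i \<in> {1..n}"
    have "area_word p i = area_word q i"
      using key[OF i] w[OF i] N_pos by (simp add: key_def)
    then show "column p i = column q i"
      using dyck_column_area[OF dyck(1) i] dyck_column_area[OF dyck(2) i] by simp
  qed
  moreover have "dv = dw"
  proof (rule inj_on_image_eq_iff[THEN iffD1, OF inj_on_key[OF dyck(1) perm(1)] dv])
    show "key p w ` dv = key p w ` dw"
      using eq calculation by (simp add: PQ word_def)
  qed
  ultimately show "P = Q" by (simp add: PQ)
qed

lemma words_subset: "words \<subseteq> word ` paths"
proof
  fix X assume "X \<in> words"
  then obtain l D where X: "X = (l, D)" and dist: "distinct l" and D: "D \<subseteq> set l"
    and inj: "inj_on (\<lambda>x. x mod N) (set l)" and im: "(\<lambda>x. x mod N) ` set l = {1..int n}"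
    and gt: "\<And>x. x \<in> set l \<Longrightarrow> - N < x" and adm: "admissible (- N) D l"
    by (auto simp: words_def)
  have len: "length l = n"
    using card_image[OF inj] im dist by (simp add: distinct_card)
  define x where "x i = l ! (i - 1)" for i
  \<comment> \<open>\<open>x = N a - w\<close> with \<open>0 < w < N\<close> means
    \<open>x + N = N a + (N - w)\<close>, so \<open>a\<close> is a quotient and \<open>N - w\<close>
    the remainder.\<close>
  define a where "a i = nat ((x i + N) div N)" for i
  define w where "w i = (if i \<in> {1..n} then nat (N - x i mod N) else i)" for i
  have l_x: "l = map x [1..<Suc n]"
    by (rule nth_equalityI) (simp_all add: len x_def del: upt_Suc)
  have x_set: "x ` {1..n} = set l"
    unfolding l_x by (simp add: atLeastLessThanSuc_atLeastAtMost del: upt_Suc)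
  have x_inj: "inj_on x {1..n}"
    using dist unfolding l_x by (simp add: distinct_map atLeastLessThanSuc_atLeastAtMost del: upt_Suc)
  have res: "x i mod N \<in> {1..int n}" if "i \<in> {1..n}" for i
    using im x_set that by blast
  have w_int: "int (w i) = N - x i mod N" if "i \<in> {1..n}" for i
    using res[OF that] that by (simp add: w_def N_eq)
  have x_eq: "x i = N * int (a i) - int (w i)" if "i \<in> {1..n}" for i
  proof -
    have "- N < x i" using gt x_set that by blast
    then have "0 \<le> x i + N" by simp
    then have "0 \<le> (x i + N) div N" using pos_imp_zdiv_nonneg_iff[OF N_pos] by blast
    then have "N * int (a i) = N * ((x i + N) div N)" by (simp only: a_def nat_0_le)
    also have "\<dots> = x i + N - x i mod N"
      by (simp only: minus_mod_eq_mult_div[symmetric] mod_add_self2)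
    finally have "N * int (a i) = x i + N - x i mod N" .
    then show ?thesis using w_int[OF that] by simp
  qed
  have w_mem: "w i \<in> {1..n}" if "i \<in> {1..n}" for i
    using res[OF that] that by (auto simp: w_def N_eq)
  have perm: "w permutes {1..n}"
  proof (rule bij_imp_permutes)
    have "inj_on w {1..n}"
    proof (rule inj_onI)
      fix i j assume ij: "i \<in> {1..n}" "j \<in> {1..n}" "w i = w j"
      then have "x i mod N = x j mod N" using w_int[of i] w_int[of j] by simp
      then have "x i = x j" using inj_onD[OF inj, of "x i" "x j"] ij x_set by blast
      then show "i = j" using x_inj ij by (auto dest: inj_onD)
    qed
    moreover have "w ` {1..n} \<subseteq> {1..n}" using w_mem by blast
    ultimately show "bij_betw w {1..n} {1..n}"
      by (simp add: bij_betw_def endo_inj_surj)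
  qed (auto simp: w_def)
  have w_bounds: "0 < int (w i)" "int (w i) < N" if "i \<in> {1..n}" for i
    using w_mem[OF that] by (auto simp: N_eq)
  have a1: "a 1 = 0" if "n \<noteq> 0"
  proof -
    have "hd l = x 1" using that len by (cases l) (auto simp: x_def)
    then have "x 1 < 0" using adm that len by (auto simp: admissible_def)
    moreover have mem: "1 \<in> {1..n}" using that by simp
    ultimately have "N * int (a 1) < N" using x_eq[OF mem] w_bounds[OF mem] by linarith
    show "a 1 = 0"
    proof (rule ccontr)
      assume "a 1 \<noteq> 0"
      then have "N * 1 \<le> N * int (a 1)" using N_pos by (intro mult_left_mono) auto
      then show False using \<open>N * int (a 1) < N\<close> by linarith
    qed
  qed
  have a_Suc: "a (Suc i) \<le> Suc (a i)" if "1 \<le> i" "i < n" for i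
  proof -
    have mem: "i \<in> {1..n}" "Suc i \<in> {1..n}" using that by auto
    have "x (Suc i) < x i + N"
      using adm that len by (cases i) (auto simp: admissible_def successively_conv_nth x_def)
    then have "N * int (a (Suc i)) - int (w (Suc i)) < N * (int (a i) + 1) - int (w i)"
      using x_eq[OF mem(1)] x_eq[OF mem(2)] by (simp add: algebra_simps)
    then show ?thesis
      using key_less[of "int (w i)" N "int (w (Suc i))" "int (a (Suc i))" "int (a i) + 1"]
        w_bounds[OF mem(1)] w_bounds[OF mem(2)] by auto
  qed
  have a_le: "a i \<le> i - 1" if "i \<in> {1..n}" for i
  proof -
    from that have "1 \<le> i" "i \<le> n" by auto
    then show ?thesis
    proof (induction i rule: dec_induct)
      case base
      then show ?case using a1 by simp
    next
      case (step i)
      then show ?case using a_Suc[of i] by simp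
    qed
  qed
  \<comment> \<open>These columns are forced by \<open>dyck_column_area\<close>. They weakly
    increase because \<open>a\<close> grows by at most one per step.\<close>
  have "\<exists>p. dyck_path n p \<and> (\<forall>i\<in>{1..n}. column p i = i - 1 - a i)"
  proof (rule dyck_path_with_columns)
    show "i - 1 - a i \<le> Suc i - 1 - a (Suc i)" if "1 \<le> i" "i < n" for i
      using a_Suc[OF that] by simp
  qed simp
  then obtain p where dyck: "dyck_path n p" and col: "\<And>i. i \<in> {1..n} \<Longrightarrow> column p i = i - 1 - a i"
    by blast
  have "area_word p i = a i" if "i \<in> {1..n}" for i
    using dyck_column_area[OF dyck that] col[OF that] a_le[OF that] by simp
  then have key: "key p w i = x i" if "i \<in> {1..n}" for i
    using that x_eq by (simp add: key_def)
  define dv where "dv = {i\<in>{1..n}. x i \<in> D}"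
  have dv: "dv \<subseteq> {1..n}" by (auto simp: dv_def)
  have l: "map (key p w) [1..<Suc n] = l"
    unfolding l_x by (rule map_cong) (auto simp: key simp del: upt_Suc)
  have "key p w ` dv = x ` dv" using key dv by (intro image_cong) auto
  also have "\<dots> = D" using D unfolding dv_def x_set[symmetric] by blast
  finally have Dv: "key p w ` dv = D" .
  have "(p, w, dv) \<in> paths"
    using admissible_word_iff[OF dyck perm dv] adm dyck unfolding l Dv by (simp add: paths_def)
  moreover have "word (p, w, dv) = X"
    unfolding X word_def prod.case l Dv ..
  ultimately show "X \<in> word ` paths" by blast
qed

lemma bij_betw_word: "bij_betw word paths words"
  using inj_on_word word_in_words words_subset by (auto simp: bij_betw_def)

lemma residues: "{1..int n} \<subseteq> {0..<N}" "(- N) mod N \<notin> {1..int n}"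
proof -
  show "{1..int n} \<subseteq> {0..<N}" by (auto simp: N_eq)
  show "(- N) mod N \<notin> {1..int n}" by simp
qed

section \<open>Comparison of the two sums\<close>

definition weight :: "int set \<Rightarrow> int set \<Rightarrow> int poly poly" where
  "weight U D = var_t ^ spread (- N) (U \<union> D) * var_z ^ card D"

lemma path_weight:
  assumes "P \<in> paths" "word P = (l, D)" "P = (p, w, dv)"
  shows "var_t ^ area n P * neg_one_powi (dinv n P) * var_z ^ card dv =
    weight (set l - D) D * ((- 1) ^ card D * (- 1) ^ attacks (set l - D) l)"
proof -
  note path = paths_D[OF assms(1)[unfolded assms(3)]]
  have l: "l = map (key p w) [1..<Suc n]" and D: "D = key p w ` dv"
    using assms(2,3) by (simp_all add: word_def)
  have set: "set l = key p w ` {1..n}" unfolding l by (rule set_word[OF path(1,2)])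
  have card: "card D = card dv"
    unfolding D by (rule card_image[OF inj_on_subset[OF inj_on_key[OF path(1,2)] path(3)]])
  have "set l - D \<union> D = key p w ` {1..n}" using set D path(3) by blast
  then have "spread (- N) (set l - D \<union> D) = area n P"
    using spread_word[OF path(1,2)] assms(3) by simp
  moreover have "attacks (set l - D) l = card (primary_dinv n P) + card (secondary_dinv n P)"
    using attacks_word[OF path] unfolding set unfolding D assms(3) l .
  \<comment> \<open>Only the parity of \<open>dinv\<close> matters, so subtracting
    \<open>card dv\<close> has the same effect as adding it.\<close>
  moreover have "neg_one_powi (dinv n P) = ((- 1) ^ card dv * (- 1) ^ (card (primary_dinv n P) + card (secondary_dinv n P)) :: int poly poly)"
    unfolding assms(3) by (simp add: neg_one_powi_def power_add[symmetric] minus_one_power_iff)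
  ultimately show ?thesis by (simp add: weight_def card)
qed

lemma finite_paths: "finite paths"
proof -
  have "paths \<subseteq> (\<Union>k\<in>{..n}. stLD n k)"
  proof
    fix P assume P: "P \<in> paths"
    obtain p w dv where "P = (p, w, dv)" using prod_cases3 by metis
    moreover from this have "card dv \<le> card {1..n}"
      using paths_D(3) P by (intro card_mono) auto
    ultimately show "P \<in> (\<Union>k\<in>{..n}. stLD n k)" using P by (auto simp: paths_def stLD_def)
  qed
  then show ?thesis by (rule finite_subset) (simp add: finite_stLD)
qed

lemma sum_stLD_eq_sum_paths:
  assumes "1 \<le> n"
  shows "(\<Sum>k=0..n - 1. (\<Sum>P\<in>stLD n k. f P) * var_z ^ k) =
    (\<Sum>(p, w, dv)\<in>paths. f (p, w, dv) * var_z ^ card dv)"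
proof -
  let ?g = "\<lambda>(p, w, dv). f (p, w, dv) * var_z ^ card dv"
  let ?c = "\<lambda>(p :: step list, w :: nat \<Rightarrow> nat, dv :: nat set). card dv"
  \<comment> \<open>Index 1 is never a valley, so the range of \<open>k\<close> covers all decorated
    paths.\<close>
  have "card dv \<le> n - 1" if "(p, w, dv) \<in> paths" for p w dv
  proof -
    have "dv \<subseteq> {2..n}" using that by (auto simp: paths_def contractible_valleys_def)
    then have "card dv \<le> card {2..n}" by (intro card_mono) auto
    then show ?thesis by simp
  qed
  then have "?c ` paths \<subseteq> {0..n - 1}" by auto
  from sum.group[OF finite_paths _ this, of ?g]
  have "(\<Sum>P\<in>paths. ?g P) = (\<Sum>k=0..n - 1. \<Sum>P | P \<in> paths \<and> ?c P = k. ?g P)"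
    by simp
  also have "\<dots> = (\<Sum>k=0..n - 1. (\<Sum>P\<in>stLD n k. f P) * var_z ^ k)"
  proof (rule sum.cong[OF refl])
    fix k
    have "{P. P \<in> paths \<and> ?c P = k} = stLD n k" by (auto simp: paths_def stLD_def)
    then have "(\<Sum>P | P \<in> paths \<and> ?c P = k. ?g P) = (\<Sum>P\<in>stLD n k. ?g P)"
      by (simp only:)
    also have "\<dots> = (\<Sum>P\<in>stLD n k. f P * var_z ^ k)"
      by (rule sum.cong) (auto simp: stLD_def)
    finally show "(\<Sum>P | P \<in> paths \<and> ?c P = k. ?g P) = (\<Sum>P\<in>stLD n k. f P) * var_z ^ k"
      by (simp only: sum_distrib_right)
  qed
  finally show ?thesis ..
qed

text \<open>Words are grouped by their undecorated and decorated values. Each group contributes its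
  \<open>signed_sum\<close>, whose sign cancels against \<open>(- 1) ^ card D\<close>, leaving the
  indicator of the parity conditions.\<close>

lemma sum_words:
  "(\<Sum>(l, D)\<in>words. weight (set l - D) D * ((- 1) ^ card D * (- 1) ^ attacks (set l - D) l)) =
    (\<Sum>(U, D)\<in>configs (- N) {1..int n}. weight U D)"
proof -
  let ?g = "\<lambda>(l, D). weight (set l - D) D * ((- 1) ^ card D * (- 1) ^ attacks (set l - D) l)"
  define base where "base = {(U, D). finite U \<and> finite D \<and> U \<inter> D = {} \<and>
     inj_on (\<lambda>x. x mod N) (U \<union> D) \<and> (\<lambda>x. x mod N) ` (U \<union> D) = {1..int n} \<and> (\<forall>x\<in>U \<union> D. - N < x)}"
  let ?split = "\<lambda>(l :: int list, D). (set l - D, D)"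
  \<comment> \<open>\<open>base\<close> puts no upper bound on the values. \<open>C\<close> is a
    finite part of it that contains both the pairs coming from words and all configurations.\<close>
  define C where "C = ?split ` words \<union> configs (- N) {1..int n}"
  have configs: "configs (- N) {1..int n} = {(U, D). (U, D) \<in> base \<and> gaps_odd (- N) U \<and> windows_odd U D}"
    by (auto simp: configs_def base_def)
  have "?split (l, D) \<in> base" if "(l, D) \<in> words" for l D
  proof -
    have "set l - D \<union> D = set l" using that by (auto simp: words_def)
    then show ?thesis using that by (auto simp: words_def base_def dest: finite_subset)
  qed
  then have C_base: "C \<subseteq> base" unfolding C_def configs by auto
  have fin_words: "finite words"
    using bij_betw_finite[OF bij_betw_word] finite_paths by blast
  have fin: "finite C"
    using fin_words finite_configs[OF _ residues] by (simp add: C_def)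
  have "(\<Sum>X\<in>words. ?g X) = (\<Sum>c\<in>C. \<Sum>X | X \<in> words \<and> ?split X = c. ?g X)"
    by (rule sum.group[symmetric]) (use fin_words fin in \<open>auto simp: C_def\<close>)
  also have "\<dots> = (\<Sum>(U, D)\<in>C. weight U D * of_bool (gaps_odd (- N) U \<and> windows_odd U D))"
  proof (rule sum.cong[OF refl])
    fix c assume "c \<in> C"
    obtain U D where c: "c = (U, D)" by (cases c)
    then have base: "(U, D) \<in> base" using C_base \<open>c \<in> C\<close> by auto
    then have fin: "finite U" "finite D" and disj: "U \<inter> D = {}"
      and inj: "inj_on (\<lambda>x. x mod N) (U \<union> D)" and gt: "\<And>x. x \<in> D \<Longrightarrow> - N < x"
      by (auto simp: base_def)
    let ?A = "{l\<in>orderings (U \<union> D). admissible (- N) D l}"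
    have "(l, D') \<in> words \<and> ?split (l, D') = c \<longleftrightarrow> D' = D \<and> l \<in> ?A" for l D'
    proof (intro iffI)
      assume "(l, D') \<in> words \<and> ?split (l, D') = c"
      then show "D' = D \<and> l \<in> ?A" by (auto simp: c words_def orderings_def)
    next
      assume *: "D' = D \<and> l \<in> ?A"
      then have l: "set l = U \<union> D" "distinct l" "admissible (- N) D l" by (auto simp: orderings_def)
      then have "set l - D = U" using disj by blast
      moreover have "(l, D) \<in> words"
        using base l(2,3) unfolding words_def base_def mem_Collect_eq prod.case l(1) by blast
      ultimately show "(l, D') \<in> words \<and> ?split (l, D') = c" using * by (simp add: c)
    qed
    then have "{X. X \<in> words \<and> ?split X = c} = (\<lambda>l. (l, D)) ` ?A"
      by (intro set_eqI) (auto simp only: split_paired_all mem_Collect_eq image_iff)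
    then have "(\<Sum>X | X \<in> words \<and> ?split X = c. ?g X) = (\<Sum>l\<in>?A. ?g (l, D))"
      by (simp add: sum.reindex inj_on_def)
    also have "\<dots> = (\<Sum>l\<in>?A. weight U D * ((- 1) ^ card D * (- 1) ^ attacks U l))"
    proof (rule sum.cong[OF refl])
      fix l assume "l \<in> ?A"
      then have "set l - D = U" using disj by (auto simp: orderings_def)
      then show "?g (l, D) = weight U D * ((- 1) ^ card D * (- 1) ^ attacks U l)" by simp
    qed
    also have "\<dots> = weight U D * ((- 1) ^ card D * of_int (signed_sum (- N) U D))"
      using finite_orderings[of "U \<union> D"] fin
      by (simp add: signed_sum_def sum_distrib_left sum.inter_filter if_distrib[of of_int] cong: if_cong)
        (rule sum.cong, auto)
    also have "\<dots> = weight U D * of_bool (gaps_odd (- N) U \<and> windows_odd U D)"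
    proof -
      have "signed_sum (- N) U D = (- 1) ^ card D * of_bool (gaps_odd (- N) U \<and> windows_odd U D)"
        by (rule signed_sum_eq[OF fin disj inj gt])
      then show ?thesis by (simp only:) (simp flip: power_add)
    qed
    finally show "(\<Sum>X | X \<in> words \<and> ?split X = c. ?g X) =
        (case c of (U, D) \<Rightarrow> weight U D * of_bool (gaps_odd (- N) U \<and> windows_odd U D))"
      by (simp add: c)
  qed
  also have "\<dots> = (\<Sum>(U, D)\<in>configs (- N) {1..int n}. weight U D)"
    by (rule sum.mono_neutral_cong_right) (use fin C_base in \<open>auto simp: C_def configs\<close>)
  finally show ?thesis .
qed

lemma path_sum_eq_permutation_sum:
  assumes "1 \<le> n"
  shows "(\<Sum>k=0..n - 1. (\<Sum>P\<in>stLD n k. var_t ^ area n P * neg_one_powi (dinv n P)) * var_z ^ k)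
       = (\<Sum>\<sigma> | \<sigma> permutes {1..n}. var_t ^ inv3 n \<sigma> * var_z ^ monot n \<sigma>)"
proof -
  let ?g = "\<lambda>(l, D). weight (set l - D) D * ((- 1) ^ card D * (- 1) ^ attacks (set l - D) l)"
  have "(\<Sum>k=0..n - 1. (\<Sum>P\<in>stLD n k. var_t ^ area n P * neg_one_powi (dinv n P)) * var_z ^ k) =
      (\<Sum>P\<in>paths. ?g (word P))"
    unfolding sum_stLD_eq_sum_paths[OF assms]
  proof (rule sum.cong[OF refl])
    fix P assume P: "P \<in> paths"
    obtain p w dv where "P = (p, w, dv)" using prod_cases3 by metis
    moreover obtain l D where "word P = (l, D)" by (cases "word P")
    ultimately show "(case P of (p, w, dv) \<Rightarrow> var_t ^ area n (p, w, dv) *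
        neg_one_powi (dinv n (p, w, dv)) * var_z ^ card dv) = ?g (word P)"
      using path_weight[OF P] by (simp del: area.simps dinv.simps)
  qed
  also have "\<dots> = (\<Sum>X\<in>words. ?g X)"
    by (rule sum.reindex_bij_betw[OF bij_betw_word])
  also have "\<dots> = (\<Sum>(U, D)\<in>configs (- N) {1..int n}. var_t ^ spread (- N) (U \<union> D) * var_z ^ card D)"
    unfolding sum_words unfolding weight_def ..
  also have "\<dots> = (\<Sum>es\<in>codes n. var_t ^ sum_list es * var_z ^ mono_steps es)"
    using sum_configs[OF _ residues, of "\<lambda>a d k. var_t ^ a * var_z ^ d"] by simp
  also have "\<dots> = (\<Sum>\<sigma> | \<sigma> permutes {1..n}. var_t ^ inv3 n \<sigma> * var_z ^ monot n \<sigma>)"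
    by (rule sum_permutations_eq_sum_codes[symmetric])
  finally show ?thesis .
qed

end

theorem theorem1p1:
  fixes n :: nat
  assumes "n \<ge> 1"
  shows "(\<Sum>k=0..n - 1. (\<Sum>P\<in>stLD n k. var_t ^ area n P * neg_one_powi (dinv n P)) * var_z ^ k)
       = (\<Sum>\<sigma> | \<sigma> permutes {1..n}. var_t ^ inv3 n \<sigma> * var_z ^ monot n \<sigma>)"
proof -
  interpret path_words "int n + 1" n by unfold_locales simp_all
  show ?thesis using assms by (rule path_sum_eq_permutation_sum)
qed

end
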